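(* Let $l,s$ be integers with $2<s\le l/2$, let $(X,\mathcal{R})$ be the $(l,s)$ Johnson scheme, and let $Y\subset X$ be the set of all $s$-element subsets of $[l]=\{1,\ldots,l\}$ that contain one fixed element of $[l]$. Then $Y$ is an extremal design on the Kneser graph $G_s=KG(l,s)$, but $Y$ is not a $t$-design on $X$ for any $t\in\{1,\ldots,s\}$.
   Context: The $(l,s)$ Johnson scheme has $X$ equal to the set of all $s$-element subsets of $[l]$ and relations $R_i=\{(A,B): |A\cap B|=s-i\}$, $i=0,\ldots,s$. $KG(l,s)=G_s=(X,R_s)$ is the graph on $X$ in which two subsets are adjacent iff they are disjoint. Extremal design: for a regular graph $G=(V,E)$ of positive degree with adjacency matrix $A$ and diagonal degree matrix $D$, let $L=AD^{-1}-I$. A nonempty $W\subset V$ integrates $\phi:V\to\mathbb{R}$ if $\frac{1}{|W|}\sum_{w\in W}\phi(w)=\frac{1}{|V|}\sum_{v\in V}\phi(v)$. $W$ is an extremal design on $G$ if there is some basis of eigenvectors of $L$ such that $W$ integrates all but one eigenvector of this basis. $t$-design: the span over $\mathbb{R}$ of the $0/1$ matrices of $R_0,\ldots,R_s$ is a commutative algebra with a unique basis of primitive idempotents $J_0,\ldots,J_s$, where $J_0$ is $\frac1{|X|}$ times the all-ones matrix. They are indexed in the standard cometric ($Q$-polynomial) ordering of the Johnson scheme: for each $i$, $\operatorname{col}(J_0)\oplus\cdots\oplus\operatorname{col}(J_i)$ is the span in $\mathbb{R}^X$ of the functions $f_S$ with $S\subset[l]$, $|S|=i$, where $f_S(A)=1$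 if $S\subset A$ and $f_S(A)=0$ otherwise. A subset $Y\subset X$ is a $t$-design on $X$ if $J_i\mathbf{1}_Y=0$ for all $i\in\{1,\ldots,t\}$, where $\mathbf{1}_Y$ is the indicator vector of $Y$. *)

theory Defs
  imports "HOL-Analysis.Analysis" "HOL-Library.Function_Algebras"
begin

text \<open>
  Real vectors and matrices indexed by a finite set \<open>V\<close> (which varies with the parameters, so it
  cannot be a type) are functions that vanish outside \<open>V\<close>, respectively outside \<open>V \<times> V\<close>. The
  pointwise vector space structure makes the library notions \<^const>\<open>span\<close> and \<^term>\<open>independent\<close>
  available for both.
\<close>

instantiation "fun" :: (type, real_vector) real_vector
begin

definition scaleR_fun :: "real \<Rightarrow> ('a \<Rightarrow> 'b) \<Rightarrow> 'a \<Rightarrow> 'b"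
  where "scaleR_fun c f = (\<lambda>x. c *\<^sub>R f x)"

instance
  by standard (simp_all add: scaleR_fun_def fun_eq_iff scaleR_add_right scaleR_add_left)

end

type_synonym 'a matrix = "'a \<Rightarrow> 'a \<Rightarrow> real"

definition vectors_on :: "'a set \<Rightarrow> ('a \<Rightarrow> real) set"
  where "vectors_on V = {f. \<forall>x. x \<notin> V \<longrightarrow> f x = 0}"

definition mat_mult :: "'a set \<Rightarrow> 'a matrix \<Rightarrow> 'a matrix \<Rightarrow> 'a matrix"
  where "mat_mult V M N = (\<lambda>x y. \<Sum>z\<in>V. M x z * N z y)"

definition mat_vec :: "'a set \<Rightarrow> 'a matrix \<Rightarrow> ('a \<Rightarrow> real) \<Rightarrow> 'a \<Rightarrow> real"
  where "mat_vec V M f = (\<lambda>x. \<Sum>y\<in>V. M x y * f y)"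

definition diag_mat :: "'a set \<Rightarrow> ('a \<Rightarrow> real) \<Rightarrow> 'a matrix"
  where "diag_mat V d = (\<lambda>x y. if x \<in> V \<and> x = y then d x else 0)"

definition relation_mat :: "('a \<times> 'a) set \<Rightarrow> 'a matrix"
  where "relation_mat R = (\<lambda>x y. if (x, y) \<in> R then 1 else 0)"

definition column_space :: "'a set \<Rightarrow> 'a matrix \<Rightarrow> ('a \<Rightarrow> real) set"
  where "column_space V M = span ((\<lambda>y x. M x y) ` V)"

definition is_eigenvector :: "'a set \<Rightarrow> 'a matrix \<Rightarrow> ('a \<Rightarrow> real) \<Rightarrow> bool"
  where "is_eigenvector V M f \<longleftrightarrow>
    f \<in> vectors_on V \<and> f \<noteq> 0 \<and> (\<exists>c. mat_vec V M f = c *\<^sub>R f)"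

definition is_direct_sum :: "'i set \<Rightarrow> ('i \<Rightarrow> 'v::real_vector set) \<Rightarrow> 'v set \<Rightarrow> bool"
  where "is_direct_sum I U W \<longleftrightarrow>
    {\<Sum>i\<in>I. u i | u. \<forall>i\<in>I. u i \<in> U i} = W \<and>
    (\<forall>u. (\<forall>i\<in>I. u i \<in> U i) \<and> (\<Sum>i\<in>I. u i) = 0 \<longrightarrow> (\<forall>i\<in>I. u i = 0))"


section \<open>Extremal designs on regular graphs\<close>

text \<open>A simple graph is given by its vertex set and its (symmetric, irreflexive) adjacency relation.\<close>

definition degree_in :: "('a \<times> 'a) set \<Rightarrow> 'a \<Rightarrow> nat"
  where "degree_in E v = card {w. (v, w) \<in> E}"

definition regular_graph :: "'a set \<Rightarrow> ('a \<times> 'a) set \<Rightarrow> bool"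
  where "regular_graph V E \<longleftrightarrow>
    finite V \<and> E \<subseteq> V \<times> V \<and> sym E \<and> irrefl E \<and>
    (\<exists>d>0. \<forall>v\<in>V. degree_in E v = d)"

text \<open>\<open>A D\<^sup>-\<^sup>1 - I\<close>, with the inverse of the diagonal degree matrix \<open>D\<close> written out entrywise.\<close>

definition laplacian :: "'a set \<Rightarrow> ('a \<times> 'a) set \<Rightarrow> 'a matrix"
  where "laplacian V E =
    mat_mult V (relation_mat E) (diag_mat V (\<lambda>v. 1 / real (degree_in E v))) - diag_mat V (\<lambda>_. 1)"

definition integrates :: "'a set \<Rightarrow> 'a set \<Rightarrow> ('a \<Rightarrow> real) \<Rightarrow> bool"
  where "integrates V W \<phi> \<longleftrightarrow>
    1 / real (card W) * (\<Sum>w\<in>W. \<phi> w) = 1 / real (card V) * (\<Sum>v\<in>V. \<phi> v)"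

definition extremal_design :: "'a set \<Rightarrow> ('a \<times> 'a) set \<Rightarrow> 'a set \<Rightarrow> bool"
  where "extremal_design V E W \<longleftrightarrow>
    regular_graph V E \<and> W \<subseteq> V \<and> W \<noteq> {} \<and>
    (\<exists>B. (\<forall>\<phi>\<in>B. is_eigenvector V (laplacian V E) \<phi>) \<and>
         independent B \<and> span B = vectors_on V \<and>
         (\<exists>!\<phi>. \<phi> \<in> B \<and> \<not> integrates V W \<phi>))"


section \<open>The Johnson scheme and its designs\<close>

definition johnson_points :: "nat \<Rightarrow> nat \<Rightarrow> nat set set"
  where "johnson_points l s = {A. A \<subseteq> {1..l} \<and> card A = s}"

definition johnson_rel :: "nat \<Rightarrow> nat \<Rightarrow> nat \<Rightarrow> (nat set \<times> nat set) set"
  where "johnson_rel l s i =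
    {(A, B). A \<in> johnson_points l s \<and> B \<in> johnson_points l s \<and> card (A \<inter> B) = s - i}"

abbreviation kneser_edges :: "nat \<Rightarrow> nat \<Rightarrow> (nat set \<times> nat set) set"
  where "kneser_edges l s \<equiv> johnson_rel l s s"

lemma kneser_edges_iff:
  "(A, B) \<in> kneser_edges l s \<longleftrightarrow>
    A \<in> johnson_points l s \<and> B \<in> johnson_points l s \<and> A \<inter> B = {}"
proof -
  have "finite A" if "A \<in> johnson_points l s" for A
    using that finite_subset by (auto simp: johnson_points_def)
  then show ?thesis
    by (auto simp: johnson_rel_def)
qed

definition johnson_algebra :: "nat \<Rightarrow> nat \<Rightarrow> nat set matrix set"
  where "johnson_algebra l s = span ((\<lambda>i. relation_mat (johnson_rel l s i)) ` {0..s})"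

definition idempotent_in :: "'a set \<Rightarrow> 'a matrix set \<Rightarrow> 'a matrix \<Rightarrow> bool"
  where "idempotent_in V \<A> M \<longleftrightarrow> M \<in> \<A> \<and> mat_mult V M M = M"

definition primitive_idempotent_in :: "'a set \<Rightarrow> 'a matrix set \<Rightarrow> 'a matrix \<Rightarrow> bool"
  where "primitive_idempotent_in V \<A> M \<longleftrightarrow>
    idempotent_in V \<A> M \<and> M \<noteq> 0 \<and>
    \<not> (\<exists>N P. idempotent_in V \<A> N \<and> idempotent_in V \<A> P \<and> N \<noteq> 0 \<and> P \<noteq> 0 \<and>
           mat_mult V N P = 0 \<and> mat_mult V P N = 0 \<and> M = N + P)"

definition superset_function :: "nat \<Rightarrow> nat \<Rightarrow> nat set \<Rightarrow> nat set \<Rightarrow> real"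
  where "superset_function l s S = (\<lambda>A. if A \<in> johnson_points l s \<and> S \<subseteq> A then 1 else 0)"

text \<open>
  The basis of primitive idempotents in the standard cometric ordering. Setting the entries with
  index greater than \<open>s\<close> to zero makes the sequence unique as a function on the natural numbers.
\<close>

definition is_cometric_idempotents :: "nat \<Rightarrow> nat \<Rightarrow> (nat \<Rightarrow> nat set matrix) \<Rightarrow> bool"
  where "is_cometric_idempotents l s J \<longleftrightarrow>
    (let X = johnson_points l s in
      (\<forall>i\<in>{0..s}. primitive_idempotent_in X (johnson_algebra l s) (J i)) \<and>
      inj_on J {0..s} \<and> independent (J ` {0..s}) \<and> span (J ` {0..s}) = johnson_algebra l s \<and>
      J 0 = (\<lambda>A B. if A \<in> X \<and> B \<in> X then 1 / real (card X) else 0) \<and>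
      (\<forall>i\<in>{0..s}. is_direct_sum {0..i} (\<lambda>j. column_space X (J j))
        (span (superset_function l s ` {S. S \<subseteq> {1..l} \<and> card S = i}))) \<and>
      (\<forall>i>s. J i = 0))"

definition johnson_idempotent :: "nat \<Rightarrow> nat \<Rightarrow> nat \<Rightarrow> nat set matrix"
  where "johnson_idempotent l s = (THE J. is_cometric_idempotents l s J)"

definition johnson_t_design :: "nat \<Rightarrow> nat \<Rightarrow> nat \<Rightarrow> nat set set \<Rightarrow> bool"
  where "johnson_t_design l s t Y \<longleftrightarrow>
    Y \<subseteq> johnson_points l s \<and>
    (\<forall>i\<in>{1..t}. mat_vec (johnson_points l s) (johnson_idempotent l s i) (indicat_real Y) = 0)"

end

theory Submission
  imports Defs "HOL-Combinatorics.Permutations"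
begin

text \<open>
  Let \<open>X\<close> be the set of \<open>s\<close>-subsets of \<open>[l]\<close>. The functions on \<open>X\<close> are filtered by degree: those
  of degree at most \<open>i\<close> are spanned by the superset functions of \<open>i\<close>-sets. Let \<open>V\<^sub>i\<close> (called
  \<open>harmonic\<close> below) be the orthogonal complement of degree less than \<open>i\<close> inside degree at most
  \<open>i\<close>, and \<open>J\<^sub>i\<close> the orthogonal projection onto \<open>V\<^sub>i\<close>.

  The symmetric group on \<open>[l]\<close> preserves the filtration and the inner product, hence every \<open>J\<^sub>i\<close>
  is invariant under it. Two pairs of \<open>s\<close>-sets with intersections of the same size differ by a
  permutation (\<open>permutation_between_pairs\<close>), so an invariant matrix is constant on the relations of
  the scheme: \<open>J\<^sub>i\<close> lies in the Johnson algebra. For \<open>i \<le> s \<le> l / 2\<close> the space \<open>V\<^sub>i\<close> is not zero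
  (\<open>harmonic_nonzero\<close>), so \<open>J\<^sub>0, \<dots>, J\<^sub>s\<close> are \<open>s + 1\<close> nonzero orthogonal idempotents in an algebra
  spanned by \<open>s + 1\<close> matrices, and therefore a basis of it. Two facts follow.

  \<^item> \<open>J\<^sub>0, \<dots>, J\<^sub>s\<close> are the primitive idempotents, and a comparison of column spaces with the
    filtration shows that the cometric ordering is the ordering by degree. So \<open>johnson_idempotent\<close>,
    which is given by a definite description, is this sequence (\<open>johnson_idempotent_eq\<close>).
  \<^item> Every matrix of the algebra, in particular the Laplacian of the Kneser graph, acts on each
    \<open>V\<^sub>i\<close> as a scalar.

  The indicator of the star \<open>Y\<close> of all sets containing \<open>a\<close> has degree at most one: it is the sum
  of the constant \<open>s / l\<close> and of a nonzero function \<open>g\<close> in \<open>V\<^sub>1\<close>. Since \<open>J\<^sub>1\<close> maps it to \<open>g\<close>, the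
  star is not a \<open>t\<close>-design for any \<open>t \<ge> 1\<close>. On the other hand the constant \<open>1\<close> and \<open>g\<close> extend to a
  basis of eigenvectors whose further members are orthogonal to both, hence have sum zero over \<open>X\<close>
  and over \<open>Y\<close>. The star integrates these and the constant, so \<open>g\<close> is the only exception.
\<close>


section \<open>Orthogonal projections in spaces of functions on a finite set\<close>

definition inner_on :: "'a set \<Rightarrow> ('a \<Rightarrow> real) \<Rightarrow> ('a \<Rightarrow> real) \<Rightarrow> real"
  where "inner_on V f g = (\<Sum>x\<in>V. f x * g x)"

lemma scaleR_fun_apply [simp]: "(c *\<^sub>R f) x = c *\<^sub>R f x"
  by (simp add: scaleR_fun_def)

lemma sum_fun_apply: "(\<Sum>i\<in>I. f i) x = (\<Sum>i\<in>I. f i x)"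
  by (induction I rule: infinite_finite_induct) simp_all

lemma inner_on_commute: "inner_on V f g = inner_on V g f"
  by (simp add: inner_on_def mult.commute)

lemma inner_on_simps:
  "inner_on V (f + g) h = inner_on V f h + inner_on V g h"
  "inner_on V (f - g) h = inner_on V f h - inner_on V g h"
  "inner_on V (c *\<^sub>R f) h = c * inner_on V f h"
  "inner_on V 0 h = 0"
  "inner_on V h (f + g) = inner_on V h f + inner_on V h g"
  "inner_on V h (f - g) = inner_on V h f - inner_on V h g"
  "inner_on V h (c *\<^sub>R f) = c * inner_on V h f"
  "inner_on V h 0 = 0"
  by (simp_all add: inner_on_def algebra_simps sum.distrib sum_distrib_left sum_subtractf)

lemma orthogonal_span:
  assumes "\<And>w. w \<in> S \<Longrightarrow> inner_on V f w = 0" and "w \<in> span S"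
  shows "inner_on V f w = 0"
proof -
  have "span S \<subseteq> {w. inner_on V f w = 0}"
    using assms(1) by (intro span_minimal) (auto simp: subspace_def inner_on_simps)
  then show ?thesis
    using assms(2) by blast
qed

lemma inner_on_self_eq_0:
  assumes "finite V" and "f \<in> vectors_on V" and "inner_on V f f = 0"
  shows "f = 0"
proof
  fix x
  have "\<forall>x\<in>V. f x * f x = 0"
    using assms(1,3) unfolding inner_on_def by (subst (asm) sum_nonneg_eq_0_iff) auto
  then show "f x = 0 x"
    using assms(2) by (cases "x \<in> V") (auto simp: vectors_on_def)
qed

lemma subspace_vectors_on: "subspace (vectors_on V)"
  by (auto simp: subspace_def vectors_on_def)

lemma vector_eq_sum_points:
  assumes "finite V" and "f \<in> vectors_on V"
  shows "f = (\<Sum>y\<in>V. f y *\<^sub>R indicat_real {y})"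
proof
  fix x
  have "(\<Sum>y\<in>V. f y *\<^sub>R indicat_real {y}) x = (\<Sum>y\<in>V. if x = y then f y else 0)"
    unfolding sum_fun_apply by (intro sum.cong) (auto simp: indicator_def)
  also have "\<dots> = f x"
    using assms by (auto simp: vectors_on_def)
  finally show "f x = (\<Sum>y\<in>V. f y *\<^sub>R indicat_real {y}) x" ..
qed

lemma subspace_finite_spanning_set:
  assumes "finite V" and "subspace U" and "U \<subseteq> vectors_on V"
  obtains B where "finite B" and "span B = U"
proof -
  obtain B where B: "B \<subseteq> U" "independent B" "U \<subseteq> span B" "card B = dim U"
    by (rule basis_exists)
  have "U \<subseteq> span ((\<lambda>y. indicat_real {y}) ` V)"
  proof
    fix f assume "f \<in> U"
    then have f: "f = (\<Sum>y\<in>V. f y *\<^sub>R indicat_real {y})"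
      using assms by (intro vector_eq_sum_points) auto
    have "(\<Sum>y\<in>V. f y *\<^sub>R indicat_real {y}) \<in> span ((\<lambda>y. indicat_real {y}) ` V)"
      by (intro span_sum span_scale span_base imageI)
    then show "f \<in> span ((\<lambda>y. indicat_real {y}) ` V)"
      using f[symmetric] by simp
  qed
  then have "finite B"
    using B independent_span_bound[of "(\<lambda>y. indicat_real {y}) ` V" B] assms(1) by blast
  moreover have "span B = U"
    using B assms(2) by (simp add: span_minimal subset_antisym)
  ultimately show ?thesis by (rule that)
qed

text \<open>
  Gram--Schmidt, organized as an induction over a spanning set: if \<open>e\<close> is what remains of the new
  vector \<open>b\<close> after its projection to the old span, then the projection of \<open>f\<close> gains the multiple of
  \<open>e\<close> that makes the remainder orthogonal to \<open>e\<close>, and thereby to \<open>b\<close>.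
\<close>

lemma orthogonal_projection_exists:
  assumes "finite V" and "subspace U" and "U \<subseteq> vectors_on V"
  shows "\<exists>u\<in>U. \<forall>w\<in>U. inner_on V (f - u) w = 0"
proof -
  obtain B where B: "finite B" "span B = U"
    using subspace_finite_spanning_set assms by blast
  have "\<exists>u\<in>span B. \<forall>w\<in>B. inner_on V (f - u) w = 0" if "B \<subseteq> vectors_on V" for f
    using B(1) that
  proof (induction B arbitrary: f rule: finite_induct)
    case empty
    then show ?case by auto
  next
    case (insert b B)
    obtain b' where b': "b' \<in> span B" "\<And>w. w \<in> B \<Longrightarrow> inner_on V (b - b') w = 0"
      using insert.IH[of b] insert.prems by blast
    obtain u where u: "u \<in> span B" "\<And>w. w \<in> B \<Longrightarrow> inner_on V (f - u) w = 0"
      using insert.IH[of f] insert.prems by blast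
    let ?e = "b - b'"
    let ?c = "inner_on V (f - u) ?e / inner_on V ?e ?e"
    have "span B \<subseteq> vectors_on V"
      using insert.prems by (simp add: span_minimal subspace_vectors_on)
    then have "?e \<in> vectors_on V"
      using b'(1) insert.prems subspace_vectors_on subspace_diff by blast
    then have "?e = 0" if "inner_on V ?e ?e = 0"
      using inner_on_self_eq_0 assms(1) that by blast
    \<comment> \<open>If \<open>e = 0\<close>, the quotient \<open>c\<close> is zero by convention and the claim is trivial.\<close>
    then have e: "inner_on V (f - u - ?c *\<^sub>R ?e) ?e = 0"
      unfolding inner_on_simps(2)[of V "f - u"] inner_on_simps(3)
      by (cases "inner_on V ?e ?e = 0") (auto simp: inner_on_simps(8))
    have old: "inner_on V (f - u - ?c *\<^sub>R ?e) w = 0" if "w \<in> span B" for w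
      using b'(2) u(2) by (intro orthogonal_span[OF _ that]) (simp add: inner_on_simps)
    have "inner_on V (f - u - ?c *\<^sub>R ?e) b = 0"
      using e old[OF b'(1)] by (simp add: inner_on_simps)
    moreover have "f - u - ?c *\<^sub>R ?e = f - (u + ?c *\<^sub>R ?e)"
      by simp
    ultimately have "\<forall>w\<in>insert b B. inner_on V (f - (u + ?c *\<^sub>R ?e)) w = 0"
      using old span_base by (metis insert_iff)
    moreover have "u + ?c *\<^sub>R ?e \<in> span (insert b B)"
      using u(1) b'(1) by (meson insertI1 span_add span_base span_diff span_mono span_scale
          subset_insertI subsetD)
    ultimately show ?case by blast
  qed
  moreover have "B \<subseteq> vectors_on V"
    using B assms(3) span_superset by blast
  ultimately obtain u where "u \<in> span B" "\<And>w. w \<in> B \<Longrightarrow> inner_on V (f - u) w = 0"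
    by blast
  then show ?thesis
    using B(2) orthogonal_span[of B V "f - u"] by blast
qed

definition orth_proj :: "'a set \<Rightarrow> ('a \<Rightarrow> real) set \<Rightarrow> ('a \<Rightarrow> real) \<Rightarrow> 'a \<Rightarrow> real"
  where "orth_proj V U f = (SOME u. u \<in> U \<and> (\<forall>w\<in>U. inner_on V (f - u) w = 0))"

context
  fixes V :: "'a set" and U :: "('a \<Rightarrow> real) set"
  assumes fin: "finite V" and sub: "subspace U" and on: "U \<subseteq> vectors_on V"
begin

lemma orth_proj_props: "orth_proj V U f \<in> U \<and> (\<forall>w\<in>U. inner_on V (f - orth_proj V U f) w = 0)"
  unfolding orth_proj_def
  using someI_ex[of "\<lambda>u. u \<in> U \<and> (\<forall>w\<in>U. inner_on V (f - u) w = 0)"]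
    orthogonal_projection_exists[OF fin sub on, of f] by blast

lemma orth_proj_mem: "orth_proj V U f \<in> U"
  using orth_proj_props by blast

lemma orth_proj_orthogonal: "w \<in> U \<Longrightarrow> inner_on V (f - orth_proj V U f) w = 0"
  using orth_proj_props by blast

lemma orth_proj_unique:
  assumes "u \<in> U" and "\<And>w. w \<in> U \<Longrightarrow> inner_on V (f - u) w = 0"
  shows "orth_proj V U f = u"
proof -
  let ?d = "orth_proj V U f - u"
  have d: "?d \<in> U"
    using orth_proj_mem assms(1) sub subspace_diff by blast
  have "inner_on V ?d ?d = inner_on V (f - u) ?d - inner_on V (f - orth_proj V U f) ?d"
    by (simp add: inner_on_simps)
  also have "\<dots> = 0"
    using d assms(2) orth_proj_orthogonal by simp
  finally have "?d = 0"
    using d on fin inner_on_self_eq_0 by blast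
  then show ?thesis by simp
qed

lemma orth_proj_id: "u \<in> U \<Longrightarrow> orth_proj V U u = u"
  by (rule orth_proj_unique) (simp_all add: inner_on_simps)

lemma orth_proj_eq_0: "(\<And>w. w \<in> U \<Longrightarrow> inner_on V f w = 0) \<Longrightarrow> orth_proj V U f = 0"
  by (rule orth_proj_unique) (simp_all add: sub subspace_0)

lemma linear_orth_proj: "linear (orth_proj V U)"
proof (rule linearI)
  fix f g :: "'a \<Rightarrow> real" and c :: real
  show "orth_proj V U (f + g) = orth_proj V U f + orth_proj V U g"
  proof (rule orth_proj_unique)
    show "orth_proj V U f + orth_proj V U g \<in> U"
      using orth_proj_mem sub subspace_add by blast
    fix w assume "w \<in> U"
    then show "inner_on V (f + g - (orth_proj V U f + orth_proj V U g)) w = 0"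
      using orth_proj_orthogonal[of w f] orth_proj_orthogonal[of w g] by (simp add: inner_on_simps)
  qed
  show "orth_proj V U (c *\<^sub>R f) = c *\<^sub>R orth_proj V U f"
  proof (rule orth_proj_unique)
    show "c *\<^sub>R orth_proj V U f \<in> U"
      using orth_proj_mem sub subspace_scale by blast
    fix w assume "w \<in> U"
    then show "inner_on V (c *\<^sub>R f - c *\<^sub>R orth_proj V U f) w = 0"
      using orth_proj_orthogonal[of w f] by (simp add: inner_on_simps)
  qed
qed

text \<open>
  The projection is characterized in terms of the inner product and \<open>U\<close> alone, so every symmetry
  of these two is a symmetry of the projection.
\<close>

lemma orth_proj_equivariant:
  assumes "bij_betw p V V" and "\<And>u. u \<in> U \<Longrightarrow> u \<circ> p \<in> U" and "\<And>w. w \<in> U \<Longrightarrow> \<exists>w'\<in>U. w = w' \<circ> p"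
  shows "orth_proj V U (f \<circ> p) = orth_proj V U f \<circ> p"
proof (rule orth_proj_unique)
  show "orth_proj V U f \<circ> p \<in> U"
    using assms(2) orth_proj_mem by blast
  fix w assume "w \<in> U"
  then obtain w' where w': "w' \<in> U" "w = w' \<circ> p"
    using assms(3) by blast
  have "inner_on V ((f \<circ> p) - (orth_proj V U f \<circ> p)) w = inner_on V (f - orth_proj V U f) w'"
    unfolding inner_on_def w'(2)
    using sum.reindex_bij_betw[OF assms(1), of "\<lambda>x. (f x - orth_proj V U f x) * w' x"] by simp
  then show "inner_on V ((f \<circ> p) - (orth_proj V U f \<circ> p)) w = 0"
    using orth_proj_orthogonal w'(1) by simp
qed

end

definition proj_mat :: "'a set \<Rightarrow> ('a \<Rightarrow> real) set \<Rightarrow> 'a matrix"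
  where "proj_mat V U = (\<lambda>x y. if y \<in> V then orth_proj V U (indicat_real {y}) x else 0)"

lemma linear_mat_vec: "linear (mat_vec V M)"
  by (rule linearI)
    (simp_all add: mat_vec_def fun_eq_iff algebra_simps sum.distrib sum_distrib_left)

lemma linear_mat_vec_left: "linear (\<lambda>M. mat_vec V M f)"
  by (rule linearI)
    (simp_all add: mat_vec_def fun_eq_iff algebra_simps sum.distrib sum_distrib_left)

lemma linear_mat_mult_left: "linear (\<lambda>M. mat_mult V M N)"
  by (rule linearI)
    (simp_all add: mat_mult_def fun_eq_iff algebra_simps sum.distrib sum_distrib_left)

lemma linear_mat_mult_right: "linear (mat_mult V M)"
  by (rule linearI)
    (simp_all add: mat_mult_def fun_eq_iff algebra_simps sum.distrib sum_distrib_left)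

lemma mat_mult_simps:
  "mat_mult V (M + N) P = mat_mult V M P + mat_mult V N P"
  "mat_mult V (M - N) P = mat_mult V M P - mat_mult V N P"
  "mat_mult V (c *\<^sub>R M) P = c *\<^sub>R mat_mult V M P"
  "mat_mult V P (M + N) = mat_mult V P M + mat_mult V P N"
  "mat_mult V P (M - N) = mat_mult V P M - mat_mult V P N"
  "mat_mult V P (c *\<^sub>R M) = c *\<^sub>R mat_mult V P M"
  by (rule linear_add[OF linear_mat_mult_left] linear_diff[OF linear_mat_mult_left]
      linear_scale[OF linear_mat_mult_left] linear_add[OF linear_mat_mult_right]
      linear_diff[OF linear_mat_mult_right] linear_scale[OF linear_mat_mult_right])+

lemma mat_mult_assoc: "mat_mult V (mat_mult V M N) P = mat_mult V M (mat_mult V N P)"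
proof (intro ext)
  fix x y
  have "mat_mult V (mat_mult V M N) P x y = (\<Sum>w\<in>V. \<Sum>z\<in>V. M x z * N z w * P w y)"
    by (simp add: mat_mult_def sum_distrib_right)
  also have "\<dots> = (\<Sum>z\<in>V. \<Sum>w\<in>V. M x z * N z w * P w y)"
    by (rule sum.swap)
  also have "\<dots> = mat_mult V M (mat_mult V N P) x y"
    by (simp add: mat_mult_def sum_distrib_left mult.assoc)
  finally show "mat_mult V (mat_mult V M N) P x y = mat_mult V M (mat_mult V N P) x y" .
qed

lemma mat_vec_columns: "mat_vec V M f = (\<Sum>y\<in>V. f y *\<^sub>R (\<lambda>x. M x y))"
  by (simp add: mat_vec_def fun_eq_iff sum_fun_apply mult.commute)

lemma mat_vec_point: "finite V \<Longrightarrow> y \<in> V \<Longrightarrow> mat_vec V M (indicat_real {y}) = (\<lambda>x. M x y)"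
  by (simp add: mat_vec_def fun_eq_iff indicator_def)

lemma mat_vec_proj_mat:
  assumes "finite V" and "subspace U" and "U \<subseteq> vectors_on V" and "f \<in> vectors_on V"
  shows "mat_vec V (proj_mat V U) f = orth_proj V U f"
proof -
  have "orth_proj V U f = orth_proj V U (\<Sum>y\<in>V. f y *\<^sub>R indicat_real {y})"
    using vector_eq_sum_points assms by metis
  also have "\<dots> = (\<Sum>y\<in>V. f y *\<^sub>R orth_proj V U (indicat_real {y}))"
    using linear_orth_proj[OF assms(1-3)] by (simp add: linear_sum linear_scale)
  also have "\<dots> = mat_vec V (proj_mat V U) f"
    unfolding mat_vec_columns by (intro sum.cong) (simp_all add: proj_mat_def)
  finally show ?thesis ..
qed

section \<open>Permutations acting on subsets\<close>

lemma finite_johnson_points: "finite (johnson_points l s)"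
  by (rule finite_subset[of _ "Pow {1..l}"]) (auto simp: johnson_points_def)

lemma finite_johnson_point: "A \<in> johnson_points l s \<Longrightarrow> finite A"
  using finite_subset by (auto simp: johnson_points_def)

lemma image_in_johnson_points_iff:
  assumes "p permutes {1..l}"
  shows "p ` A \<in> johnson_points l s \<longleftrightarrow> A \<in> johnson_points l s"
proof -
  have "p ` A \<subseteq> p ` {1..l} \<longleftrightarrow> A \<subseteq> {1..l}"
    using permutes_inj[OF assms] by (rule inj_image_subset_iff)
  moreover have "card (p ` A) = card A"
    using permutes_inj_on[OF assms] by (rule card_image)
  ultimately show ?thesis
    using permutes_image[OF assms] by (simp add: johnson_points_def)
qed

lemma bij_betw_image_johnson_points:
  assumes "p permutes {1..l}"
  shows "bij_betw ((`) p) (johnson_points l s) (johnson_points l s)"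
proof (rule bij_betw_byWitness[where f' = "(`) (inv p)"])
  show "\<forall>A\<in>johnson_points l s. inv p ` p ` A = A" "\<forall>A\<in>johnson_points l s. p ` inv p ` A = A"
    using permutes_inverses[OF assms] by (auto simp: image_image)
  show "(`) p ` johnson_points l s \<subseteq> johnson_points l s"
    using image_in_johnson_points_iff[OF assms] by auto
  show "(`) (inv p) ` johnson_points l s \<subseteq> johnson_points l s"
    using image_in_johnson_points_iff[OF permutes_inv[OF assms]] by auto
qed

text \<open>
  Two pairs of \<open>s\<close>-subsets with equally large intersections cut \<open>[l]\<close> into four pieces of the same
  sizes, and bijections between corresponding pieces glue to a permutation of \<open>[l]\<close>.
\<close>

lemma permutation_between_pairs:
  assumes A: "A \<in> johnson_points l s" and B: "B \<in> johnson_points l s"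
    and C: "C \<in> johnson_points l s" and D: "D \<in> johnson_points l s"
    and eq: "card (A \<inter> B) = card (C \<inter> D)"
  obtains p where "p permutes {1..l}" and "p ` A = C" and "p ` B = D"
proof -
  note fin = A[THEN finite_johnson_point] B[THEN finite_johnson_point]
    C[THEN finite_johnson_point] D[THEN finite_johnson_point]
  have sub: "A \<subseteq> {1..l}" "B \<subseteq> {1..l}" "C \<subseteq> {1..l}" "D \<subseteq> {1..l}"
    and card: "card A = s" "card B = s" "card C = s" "card D = s"
    using A B C D by (auto simp: johnson_points_def)
  have outside: "card ({1..l} - (A' \<union> B')) = l - (s + s - card (A' \<inter> B'))"
    if "A' \<in> johnson_points l s" "B' \<in> johnson_points l s" for A' B'
  proof -
    have "finite A'" "finite B'" "A' \<union> B' \<subseteq> {1..l}" "card A' = s" "card B' = s"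
      using that[THEN finite_johnson_point] that by (auto simp: johnson_points_def)
    moreover from this have "card (A' \<union> B') = s + s - card (A' \<inter> B')"
      using card_Un_Int[of A' B'] by simp
    ultimately show ?thesis
      by (simp add: card_Diff_subset)
  qed
  obtain f1 where f1: "bij_betw f1 (A \<inter> B) (C \<inter> D)"
    using finite_same_card_bij[of "A \<inter> B" "C \<inter> D"] eq fin by auto
  have "card (A - B) = card (C - D)" "card (B - A) = card (D - C)"
    using fin card eq by (simp_all add: card_Diff_subset_Int Int_commute)
  then obtain f2 f3 where f2: "bij_betw f2 (A - B) (C - D)" and f3: "bij_betw f3 (B - A) (D - C)"
    using finite_same_card_bij[of "A - B" "C - D"] finite_same_card_bij[of "B - A" "D - C"] fin
    by auto
  have "card ({1..l} - (A \<union> B)) = card ({1..l} - (C \<union> D))"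
    using outside[OF A B] outside[OF C D] eq by simp
  then obtain f4 where f4: "bij_betw f4 ({1..l} - (A \<union> B)) ({1..l} - (C \<union> D))"
    using finite_same_card_bij[of "{1..l} - (A \<union> B)" "{1..l} - (C \<union> D)"] by auto
  define p where "p x = (if x \<in> A \<inter> B then f1 x else if x \<in> A - B then f2 x
      else if x \<in> B - A then f3 x else if x \<in> {1..l} then f4 x else x)" for x
  have "p x = f1 x" if "x \<in> A \<inter> B" for x
    using that by (simp add: p_def)
  moreover have "p x = f2 x" if "x \<in> A - B" for x
    using that by (simp add: p_def)
  moreover have "p x = f3 x" if "x \<in> B - A" for x
    using that by (simp add: p_def)
  moreover have "p x = f4 x" if "x \<in> {1..l} - (A \<union> B)" for x
    using that by (simp add: p_def)
  ultimately have p: "bij_betw p (A \<inter> B) (C \<inter> D)" "bij_betw p (A - B) (C - D)"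
    "bij_betw p (B - A) (D - C)" "bij_betw p ({1..l} - (A \<union> B)) ({1..l} - (C \<union> D))"
    using f1 f2 f3 f4 by (metis (no_types, lifting) bij_betw_cong)+
  have "bij_betw p ((A \<inter> B) \<union> (A - B)) ((C \<inter> D) \<union> (C - D))"
    using p by (intro bij_betw_combine) auto
  then have pA: "bij_betw p A C"
    by (simp only: Int_Diff_Un)
  have "bij_betw p ((A \<inter> B) \<union> (B - A)) ((C \<inter> D) \<union> (D - C))"
    using p by (intro bij_betw_combine) auto
  then have pB: "bij_betw p B D"
    by (simp only: Int_Diff_Un Int_commute[of A] Int_commute[of C])
  have "bij_betw p (A \<union> (B - A)) (C \<union> (D - C))"
    using p pA by (intro bij_betw_combine) auto
  then have "bij_betw p (A \<union> B) (C \<union> D)"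
    by (simp only: Un_Diff_cancel)
  then have "bij_betw p ((A \<union> B) \<union> ({1..l} - (A \<union> B))) ((C \<union> D) \<union> ({1..l} - (C \<union> D)))"
    using p(4) by (rule bij_betw_combine) auto
  moreover have "(A \<union> B) \<union> ({1..l} - (A \<union> B)) = {1..l}" "(C \<union> D) \<union> ({1..l} - (C \<union> D)) = {1..l}"
    using sub by auto
  ultimately have "bij_betw p {1..l} {1..l}"
    by simp
  moreover have "p x = x" if "x \<notin> {1..l}" for x
    using that sub by (auto simp: p_def)
  ultimately have "p permutes {1..l}"
    by (rule bij_imp_permutes)
  then show ?thesis
    using that pA pB by (simp add: bij_betw_def)
qed


section \<open>The filtration by degree\<close>

text \<open>
  The index bounds the degree strictly. The filtration then starts at the zero space, and degree
  zero needs no separate treatment in differences of consecutive steps.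
\<close>

definition low_degree :: "nat \<Rightarrow> nat \<Rightarrow> nat \<Rightarrow> (nat set \<Rightarrow> real) set"
  where "low_degree l s n = span (superset_function l s ` {S. S \<subseteq> {1..l} \<and> card S < n})"

lemma superset_function_in_low_degree:
  "S \<subseteq> {1..l} \<Longrightarrow> card S < n \<Longrightarrow> superset_function l s S \<in> low_degree l s n"
  unfolding low_degree_def by (intro span_base) auto

lemma subspace_low_degree: "subspace (low_degree l s n)"
  by (simp add: low_degree_def)

lemma low_degree_0: "low_degree l s 0 = {0}"
  by (simp add: low_degree_def)

lemma low_degree_mono: "m \<le> n \<Longrightarrow> low_degree l s m \<subseteq> low_degree l s n"
  unfolding low_degree_def by (intro span_mono) auto

lemma superset_function_in_vectors_on: "superset_function l s S \<in> vectors_on (johnson_points l s)"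
  by (simp add: superset_function_def vectors_on_def)

lemma low_degree_subset: "low_degree l s n \<subseteq> vectors_on (johnson_points l s)"
  unfolding low_degree_def
  by (intro span_minimal subspace_vectors_on) (auto intro: superset_function_in_vectors_on)

lemmas low_degree_facts = finite_johnson_points subspace_low_degree low_degree_subset

text \<open>
  The filtration is invariant under permutations because they permute the superset functions.
\<close>

lemma superset_function_image:
  assumes "p permutes {1..l}"
  shows "superset_function l s S \<circ> (`) p = superset_function l s (inv p ` S)"
proof
  fix A
  have "S \<subseteq> p ` A \<longleftrightarrow> inv p ` S \<subseteq> A"
    using inj_image_subset_iff[OF permutes_inj[OF assms], of "inv p ` S" A]
    by (simp add: image_image permutes_inverses[OF assms])
  then show "(superset_function l s S \<circ> (`) p) A = superset_function l s (inv p ` S) A"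
    using image_in_johnson_points_iff[OF assms] by (simp add: superset_function_def)
qed

lemma low_degree_image:
  assumes "p permutes {1..l}" and "f \<in> low_degree l s n"
  shows "f \<circ> (`) p \<in> low_degree l s n"
proof -
  have "subspace {f. f \<circ> (`) p \<in> low_degree l s n}"
  proof -
    have "(f + g) \<circ> (`) p = (f \<circ> (`) p) + (g \<circ> (`) p)" "(c *\<^sub>R f) \<circ> (`) p = c *\<^sub>R (f \<circ> (`) p)"
      "0 \<circ> (`) p = (0 :: nat set \<Rightarrow> real)" for f g :: "nat set \<Rightarrow> real" and c
      by (simp_all add: fun_eq_iff)
    then show ?thesis
      using subspace_low_degree[of l s n] by (simp add: subspace_def)
  qed
  moreover have "superset_function l s S \<circ> (`) p \<in> low_degree l s n"
    if "S \<subseteq> {1..l}" "card S < n" for S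
  proof -
    note inv = permutes_inv[OF assms(1)]
    have "inv p ` S \<subseteq> {1..l}"
      using image_mono[OF that(1), of "inv p"] permutes_image[OF inv] by simp
    moreover have "card (inv p ` S) = card S"
      using permutes_inj_on[OF inv] by (rule card_image)
    ultimately show ?thesis
      using that by (simp add: superset_function_image[OF assms(1)] superset_function_in_low_degree)
  qed
  ultimately have "span (superset_function l s ` {S. S \<subseteq> {1..l} \<and> card S < n})
      \<subseteq> {f. f \<circ> (`) p \<in> low_degree l s n}"
    by (metis (no_types, lifting) span_minimal image_subsetI mem_Collect_eq)
  then show ?thesis
    using assms(2) unfolding low_degree_def by blast
qed

text \<open>
  An \<open>s\<close>-set containing \<open>S\<close> contains exactly \<open>s - |S|\<close> of the one-point extensions of \<open>S\<close>. Hence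
  functions of lower degree are recovered from those of higher degree.
\<close>

lemma superset_function_eq_sum_extensions:
  assumes "S \<subseteq> {1..l}" and "card S < s"
  shows "superset_function l s S =
    (1 / real (s - card S)) *\<^sub>R (\<Sum>x\<in>{1..l} - S. superset_function l s (insert x S))"
proof
  fix A
  have "(\<Sum>x\<in>{1..l} - S. superset_function l s (insert x S)) A
      = real (s - card S) * superset_function l s S A"
  proof (cases "A \<in> johnson_points l s \<and> S \<subseteq> A")
    case True
    then have A: "A \<subseteq> {1..l}" "card A = s" "finite A" "S \<subseteq> A"
      using finite_johnson_point[of A l s] by (auto simp: johnson_points_def)
    have "(\<Sum>x\<in>{1..l} - S. superset_function l s (insert x S)) A
        = (\<Sum>x\<in>{1..l} - S. if x \<in> A then 1 else 0)"
      unfolding sum_fun_apply using True by (intro sum.cong) (auto simp: superset_function_def)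
    also have "\<dots> = real (card (({1..l} - S) \<inter> A))"
      by (simp flip: sum.inter_restrict)
    also have "({1..l} - S) \<inter> A = A - S"
      using A by auto
    also have "card (A - S) = s - card S"
      using A by (simp add: card_Diff_subset finite_subset)
    finally show ?thesis
      using True by (simp add: superset_function_def)
  next
    case False
    then have "superset_function l s (insert x S) A = 0" "superset_function l s S A = 0" for x
      by (auto simp: superset_function_def)
    then show ?thesis
      by (simp add: sum_fun_apply)
  qed
  then show "superset_function l s S A = ((1 / real (s - card S)) *\<^sub>R
      (\<Sum>x\<in>{1..l} - S. superset_function l s (insert x S))) A"
    using assms(2) by simp
qed

lemma low_degree_Suc:
  assumes "i \<le> s"
  shows "low_degree l s (Suc i) = span (superset_function l s ` {S. S \<subseteq> {1..l} \<and> card S = i})"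
    (is "_ = span ?F")
proof
  have "superset_function l s S \<in> span ?F" if "S \<subseteq> {1..l}" "card S \<le> i" for S
    using that
  proof (induction "i - card S" arbitrary: S)
    case 0
    then show ?case by (intro span_base) auto
  next
    case (Suc n)
    have "finite S"
      using Suc.prems(1) finite_subset by blast
    then have "superset_function l s (insert x S) \<in> span ?F" if "x \<in> {1..l} - S" for x
      using Suc that by (intro Suc.hyps(1)) auto
    then have "(1 / real (s - card S)) *\<^sub>R
        (\<Sum>x\<in>{1..l} - S. superset_function l s (insert x S)) \<in> span ?F"
      by (intro span_scale span_sum)
    moreover have "card S < s"
      using Suc.hyps(2) assms by simp
    ultimately show ?case
      by (simp only: superset_function_eq_sum_extensions[OF Suc.prems(1)])
  qed
  then show "low_degree l s (Suc i) \<subseteq> span ?F"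
    unfolding low_degree_def by (intro span_minimal) auto
  show "span ?F \<subseteq> low_degree l s (Suc i)"
    unfolding low_degree_def by (intro span_mono) auto
qed

lemma low_degree_1: "low_degree l s (Suc 0) = span {superset_function l s {}}"
proof -
  have "{S. S \<subseteq> {1..l} \<and> card S = 0} = {{}}"
    using finite_subset[of _ "{1..l}"] by (auto simp: card_eq_0_iff)
  then show ?thesis
    using low_degree_Suc[of 0 s l] by simp
qed

lemma low_degree_top:
  assumes "s < n"
  shows "low_degree l s n = vectors_on (johnson_points l s)"
proof (rule antisym[OF low_degree_subset], rule subsetI)
  fix f assume "f \<in> vectors_on (johnson_points l s)"
  then have f: "f = (\<Sum>A\<in>johnson_points l s. f A *\<^sub>R indicat_real {A})"
    using finite_johnson_points by (intro vector_eq_sum_points)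
  have "indicat_real {A} \<in> low_degree l s n" if "A \<in> johnson_points l s" for A
  proof -
    have "A \<subseteq> B \<longleftrightarrow> B = A" if "B \<in> johnson_points l s" for B
      using card_subset_eq[OF finite_johnson_point[OF that], of A] that \<open>A \<in> johnson_points l s\<close>
      by (auto simp: johnson_points_def)
    then have "indicat_real {A} B = superset_function l s A B" for B
      using that by (auto simp: superset_function_def indicator_def)
    then have "indicat_real {A} = superset_function l s A"
      by (rule ext)
    moreover have "superset_function l s A \<in> low_degree l s n"
      using that assms by (intro superset_function_in_low_degree) (auto simp: johnson_points_def)
    ultimately show ?thesis by simp
  qed
  then have "(\<Sum>A\<in>johnson_points l s. f A *\<^sub>R indicat_real {A}) \<in> low_degree l s n"
    using subspace_low_degree by (intro subspace_sum subspace_scale) auto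
  then show "f \<in> low_degree l s n"
    using f[symmetric] by simp
qed

text \<open>
  For \<open>i \<le> s \<le> l / 2\<close> these are the common eigenspaces of the Johnson scheme, known as the spaces
  of harmonic functions of degree \<open>i\<close>. Beyond degree \<open>s\<close> the filtration is stationary, and the
  space is zero.
\<close>

definition harmonic :: "nat \<Rightarrow> nat \<Rightarrow> nat \<Rightarrow> (nat set \<Rightarrow> real) set"
  where "harmonic l s i = {f \<in> low_degree l s (Suc i).
    \<forall>g\<in>low_degree l s i. inner_on (johnson_points l s) f g = 0}"

text \<open>
  Each factor is a difference of two indicators, so expanding the product one factor at a time adds
  \<open>p k\<close> or \<open>q k\<close> to the set \<open>S\<close>. The leading superset function is what makes the induction go
  through.
\<close>

lemma pair_product_in_low_degree:
  assumes "finite K" and "p ` K \<subseteq> {1..l}" and "q ` K \<subseteq> {1..l}" and "S \<subseteq> {1..l}"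
    and "card S + card K < n"
  shows "(\<lambda>A. superset_function l s S A * (\<Prod>k\<in>K. of_bool (p k \<in> A) - of_bool (q k \<in> A)))
    \<in> low_degree l s n"
  using assms
proof (induction K arbitrary: S rule: finite_induct)
  case empty
  then show ?case
    by (simp add: superset_function_in_low_degree)
next
  case (insert k K)
  let ?f = "\<lambda>S A. superset_function l s S A * (\<Prod>k\<in>K. of_bool (p k \<in> A) - of_bool (q k \<in> A))"
  have "finite S"
    using insert.prems(3) finite_subset by blast
  then have "?f (insert x S) \<in> low_degree l s n" if "x \<in> {1..l}" for x
    using insert.prems insert.hyps that
    by (intro insert.IH) (auto simp: card_insert_if split: if_splits)
  then have "?f (insert (p k) S) - ?f (insert (q k) S) \<in> low_degree l s n"
    using insert.prems by (intro subspace_diff subspace_low_degree) auto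
  also have "?f (insert (p k) S) - ?f (insert (q k) S) =
      (\<lambda>A. superset_function l s S A *
        (\<Prod>k\<in>insert k K. of_bool (p k \<in> A) - of_bool (q k \<in> A)))"
    using insert.hyps by (auto simp: fun_eq_iff superset_function_def)
  finally show ?case .
qed

text \<open>
  The witness is the product of \<open>x\<^sub>k - x\<^sub>i\<^sub>+\<^sub>k\<close> over \<open>k = 1, \<dots>, i\<close>, where \<open>x\<^sub>k\<close> is the indicator of
  the sets containing \<open>k\<close>. A set \<open>S\<close> with fewer than \<open>i\<close> elements misses one of the pairs
  \<open>{k, i + k}\<close>, and exchanging the two elements of that pair changes the sign of the product while
  it preserves the superset function of \<open>S\<close>. The bound on \<open>s\<close> makes room for an \<open>s\<close>-set that
  contains \<open>1, \<dots>, i\<close> and avoids \<open>i + 1, \<dots>, 2 i\<close>.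
\<close>

lemma harmonic_nonzero:
  assumes "i \<le> s" and "2 * s \<le> l"
  shows "\<exists>h\<in>harmonic l s i. h \<noteq> 0"
proof -
  let ?X = "johnson_points l s"
  define h where "h A = superset_function l s {} A *
    (\<Prod>k\<in>{1..i}. of_bool (k \<in> A) - of_bool (i + k \<in> A))" for A
  have "h \<in> low_degree l s (Suc i)"
    using pair_product_in_low_degree[of "{1..i}" "\<lambda>k. k" l "\<lambda>k. i + k" "{}" "Suc i" s] assms
    unfolding h_def[abs_def] by (auto simp: image_subset_iff)
  moreover have "inner_on ?X h (superset_function l s S) = 0"
    if S: "S \<subseteq> {1..l}" "card S < i" for S
  proof -
    have "\<exists>k\<in>{1..i}. k \<notin> S \<and> i + k \<notin> S"
    proof (rule ccontr)
      assume "\<not> ?thesis"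
      then have "{1..i} \<subseteq> (\<lambda>x. if x \<le> i then x else x - i) ` S"
        by (force simp: image_iff)
      moreover have "finite S"
        using S(1) finite_subset by blast
      ultimately have "card {1..i} \<le> card S"
        by (meson card_image_le card_mono finite_imageI order_trans)
      then show False
        using S(2) by simp
    qed
    then obtain k where k: "k \<in> {1..i}" "k \<notin> S" "i + k \<notin> S"
      by blast
    define t where "t = Transposition.transpose k (i + k)"
    have t: "t permutes {1..l}"
      using k assms unfolding t_def by (intro permutes_swap_id) auto
    have mem: "x \<in> t ` A \<longleftrightarrow> t x \<in> A" for x A
    proof -
      have "t (t y) = y" for y
        by (simp add: t_def)
      then show ?thesis
        by (metis image_iff)
    qed
    have tk: "t k = i + k" "t (i + k) = k" and t_fix: "x \<noteq> k \<Longrightarrow> x \<noteq> i + k \<Longrightarrow> t x = x" for x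
      by (simp_all add: t_def)
    have split: "h A = superset_function l s {} A * ((of_bool (k \<in> A) - of_bool (i + k \<in> A)) *
        (\<Prod>j\<in>{1..i} - {k}. of_bool (j \<in> A) - of_bool (i + j \<in> A)))" for A
      unfolding h_def prod.remove[OF finite_atLeastAtMost k(1)] ..
    have "h (t ` A) = - h A" for A
    proof -
      have others: "(\<Prod>j\<in>{1..i} - {k}. of_bool (j \<in> t ` A) - of_bool (i + j \<in> t ` A))
          = (\<Prod>j\<in>{1..i} - {k}. of_bool (j \<in> A) - of_bool (i + j \<in> A) :: real)"
        using k(1) by (intro prod.cong) (simp_all add: mem t_fix)
      have exchanged: "of_bool (k \<in> t ` A) - of_bool (i + k \<in> t ` A)
          = - (of_bool (k \<in> A) - of_bool (i + k \<in> A) :: real)"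
        by (simp add: mem tk)
      have "superset_function l s {} (t ` A) = superset_function l s {} A"
        using image_in_johnson_points_iff[OF t] by (simp add: superset_function_def)
      then show ?thesis
        unfolding split others exchanged by simp
    qed
    moreover have "superset_function l s S (t ` A) = superset_function l s S A" for A
    proof -
      have "S \<subseteq> t ` A \<longleftrightarrow> S \<subseteq> A"
        using k t_fix unfolding subset_iff mem by metis
      then show ?thesis
        using image_in_johnson_points_iff[OF t] by (simp add: superset_function_def)
    qed
    ultimately have "inner_on ?X h (superset_function l s S) = - inner_on ?X h (superset_function l s S)"
      using sum.reindex_bij_betw[OF bij_betw_image_johnson_points[OF t],
          of "\<lambda>A. h A * superset_function l s S A" s]
      by (simp add: inner_on_def sum_negf)
    then show ?thesis by simp
  qed
  then have "\<And>w. w \<in> superset_function l s ` {S. S \<subseteq> {1..l} \<and> card S < i} \<Longrightarrow> inner_on ?X h w = 0"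
    by blast
  then have "inner_on ?X h g = 0" if "g \<in> low_degree l s i" for g
    using that unfolding low_degree_def by (rule orthogonal_span)
  moreover have "h \<noteq> 0"
  proof -
    define A where "A = {1..i} \<union> {2 * i + 1..i + s}"
    have "A \<in> ?X"
    proof -
      have "card A = i + (i + s - 2 * i)"
        unfolding A_def by (subst card_Un_disjoint) auto
      then show ?thesis
        using assms by (auto simp: johnson_points_def A_def)
    qed
    moreover have "(\<Prod>k\<in>{1..i}. of_bool (k \<in> A) - of_bool (i + k \<in> A)) = (1 :: real)"
      by (intro prod.neutral) (auto simp: A_def)
    ultimately have "h A = 1"
      by (simp add: h_def superset_function_def)
    then show ?thesis by auto
  qed
  ultimately show ?thesis
    unfolding harmonic_def by blast
qed


section \<open>The harmonic projections\<close>

lemma subspace_harmonic: "subspace (harmonic l s i)"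
  using subspace_low_degree[of l s "Suc i"]
  by (simp add: subspace_def harmonic_def inner_on_simps)

lemma harmonic_subset_low_degree: "i < n \<Longrightarrow> harmonic l s i \<subseteq> low_degree l s n"
  using low_degree_mono[of "Suc i" n l s] by (auto simp: harmonic_def)

lemma harmonic_subset: "harmonic l s i \<subseteq> vectors_on (johnson_points l s)"
  using harmonic_subset_low_degree low_degree_subset by blast

text \<open>
  A harmonic function of degree \<open>j\<close> is either inside a step of the filtration or orthogonal to it.
  The multiplication table of the harmonic projections follows from this alone.
\<close>

lemma orth_proj_low_degree_harmonic:
  assumes "v \<in> harmonic l s j"
  shows "orth_proj (johnson_points l s) (low_degree l s n) v = (if j < n then v else 0)"
proof (cases "j < n")
  case True
  then have "v \<in> low_degree l s n"
    using assms harmonic_subset_low_degree by blast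
  then show ?thesis
    using True by (simp add: orth_proj_id[OF low_degree_facts])
next
  case False
  then have "inner_on (johnson_points l s) v w = 0" if "w \<in> low_degree l s n" for w
    using assms that low_degree_mono[of n j l s] by (auto simp: harmonic_def)
  then show ?thesis
    using False by (simp add: orth_proj_eq_0[OF low_degree_facts])
qed

definition harmonic_proj :: "nat \<Rightarrow> nat \<Rightarrow> nat \<Rightarrow> nat set matrix"
  where "harmonic_proj l s i = proj_mat (johnson_points l s) (low_degree l s (Suc i))
    - proj_mat (johnson_points l s) (low_degree l s i)"

lemma mat_vec_harmonic_proj:
  assumes "f \<in> vectors_on (johnson_points l s)"
  shows "mat_vec (johnson_points l s) (harmonic_proj l s i) f =
    orth_proj (johnson_points l s) (low_degree l s (Suc i)) f
    - orth_proj (johnson_points l s) (low_degree l s i) f"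
  by (simp add: harmonic_proj_def linear_diff[OF linear_mat_vec_left]
      mat_vec_proj_mat[OF low_degree_facts assms])

lemma mat_vec_harmonic_proj_in_harmonic:
  assumes "f \<in> vectors_on (johnson_points l s)"
  shows "mat_vec (johnson_points l s) (harmonic_proj l s i) f \<in> harmonic l s i"
proof -
  let ?X = "johnson_points l s"
  let ?P = "\<lambda>n. orth_proj ?X (low_degree l s n) f"
  have "?P n \<in> low_degree l s n" for n
    by (rule orth_proj_mem[OF low_degree_facts])
  moreover have "inner_on ?X (?P (Suc i) - ?P i) g = 0" if "g \<in> low_degree l s i" for g
  proof -
    have "g \<in> low_degree l s (Suc i)"
      using that low_degree_mono[of i "Suc i" l s] by auto
    then show ?thesis
      using that orth_proj_orthogonal[OF low_degree_facts, of g l s i f]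
        orth_proj_orthogonal[OF low_degree_facts, of g l s "Suc i" f]
      by (simp add: inner_on_simps)
  qed
  moreover have "low_degree l s i \<subseteq> low_degree l s (Suc i)"
    by (rule low_degree_mono) simp
  ultimately show ?thesis
    unfolding mat_vec_harmonic_proj[OF assms] harmonic_def
    using subspace_diff[OF subspace_low_degree] by blast
qed

lemma mat_vec_harmonic_proj_harmonic:
  assumes "v \<in> harmonic l s j"
  shows "mat_vec (johnson_points l s) (harmonic_proj l s i) v = (if i = j then v else 0)"
proof -
  have "v \<in> vectors_on (johnson_points l s)"
    using assms harmonic_subset by blast
  then show ?thesis
    by (auto simp: mat_vec_harmonic_proj orth_proj_low_degree_harmonic[OF assms])
qed

lemma harmonic_proj_column: "(\<lambda>x. harmonic_proj l s i x y) \<in> harmonic l s i"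
proof (cases "y \<in> johnson_points l s")
  case True
  then have "indicat_real {y} \<in> vectors_on (johnson_points l s)"
    by (auto simp: vectors_on_def indicator_def)
  then show ?thesis
    using mat_vec_harmonic_proj_in_harmonic mat_vec_point[OF finite_johnson_points True] by metis
next
  case False
  then have "(\<lambda>x. harmonic_proj l s i x y) = 0"
    by (simp add: harmonic_proj_def proj_mat_def fun_eq_iff)
  then show ?thesis
    using subspace_0[OF subspace_harmonic] by simp
qed

lemma harmonic_proj_mult:
  "mat_mult (johnson_points l s) (harmonic_proj l s i) (harmonic_proj l s j) =
    (if i = j then harmonic_proj l s i else 0)"
proof (intro ext)
  fix x y
  have "mat_mult (johnson_points l s) (harmonic_proj l s i) (harmonic_proj l s j) x y
      = mat_vec (johnson_points l s) (harmonic_proj l s i) (\<lambda>z. harmonic_proj l s j z y) x"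
    by (simp add: mat_mult_def mat_vec_def)
  also have "\<dots> = (if i = j then (\<lambda>z. harmonic_proj l s j z y) else 0) x"
    by (simp only: mat_vec_harmonic_proj_harmonic[OF harmonic_proj_column])
  finally show "mat_mult (johnson_points l s) (harmonic_proj l s i) (harmonic_proj l s j) x y
      = (if i = j then harmonic_proj l s i else 0) x y"
    by simp
qed

lemma sum_mat_vec_harmonic_proj:
  assumes "f \<in> low_degree l s (Suc i)"
  shows "(\<Sum>j\<in>{0..i}. mat_vec (johnson_points l s) (harmonic_proj l s j) f) = f"
proof -
  let ?P = "\<lambda>n. orth_proj (johnson_points l s) (low_degree l s n) f"
  have "f \<in> vectors_on (johnson_points l s)"
    using assms low_degree_subset by blast
  then have "(\<Sum>j\<in>{0..i}. mat_vec (johnson_points l s) (harmonic_proj l s j) f)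
      = (\<Sum>j\<in>{0..i}. ?P (Suc j) - ?P j)"
    by (simp only: mat_vec_harmonic_proj)
  also have "\<dots> = ?P (Suc i) - ?P 0"
    by (rule sum_Suc_diff) simp
  also have "?P (Suc i) = f"
    using assms by (rule orth_proj_id[OF low_degree_facts])
  also have "?P 0 = 0"
    using orth_proj_mem[OF low_degree_facts, of l s 0 f] by (simp add: low_degree_0)
  finally show ?thesis by simp
qed

lemma column_space_harmonic_proj:
  "column_space (johnson_points l s) (harmonic_proj l s i) = harmonic l s i"
proof
  show "column_space (johnson_points l s) (harmonic_proj l s i) \<subseteq> harmonic l s i"
    unfolding column_space_def
    by (intro span_minimal subspace_harmonic) (use harmonic_proj_column in blast)
  show "harmonic l s i \<subseteq> column_space (johnson_points l s) (harmonic_proj l s i)"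
  proof
    fix v assume "v \<in> harmonic l s i"
    then have "(\<Sum>y\<in>johnson_points l s. v y *\<^sub>R (\<lambda>x. harmonic_proj l s i x y)) = v"
      using mat_vec_harmonic_proj_harmonic[of v l s i i] by (simp flip: mat_vec_columns)
    moreover have "(\<Sum>y\<in>johnson_points l s. v y *\<^sub>R (\<lambda>x. harmonic_proj l s i x y))
        \<in> span ((\<lambda>y x. harmonic_proj l s i x y) ` johnson_points l s)"
      by (intro span_sum span_scale span_base imageI)
    ultimately show "v \<in> column_space (johnson_points l s) (harmonic_proj l s i)"
      by (simp only: column_space_def)
  qed
qed

lemma direct_sum_harmonic:
  "is_direct_sum {0..i} (harmonic l s) (low_degree l s (Suc i))"
proof -
  have "(\<Sum>j\<in>{0..i}. u j) \<in> low_degree l s (Suc i)" if "\<forall>j\<in>{0..i}. u j \<in> harmonic l s j" for u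
    using that harmonic_subset_low_degree[of _ "Suc i" l s]
    by (intro subspace_sum subspace_low_degree) (meson atLeastAtMost_iff le_imp_less_Suc subsetD)
  moreover have "\<exists>u. f = (\<Sum>j\<in>{0..i}. u j) \<and> (\<forall>j\<in>{0..i}. u j \<in> harmonic l s j)"
    if "f \<in> low_degree l s (Suc i)" for f
  proof (intro exI conjI ballI)
    show "f = (\<Sum>j\<in>{0..i}. mat_vec (johnson_points l s) (harmonic_proj l s j) f)"
      using sum_mat_vec_harmonic_proj[OF that] by simp
    show "mat_vec (johnson_points l s) (harmonic_proj l s j) f \<in> harmonic l s j" for j
      using that low_degree_subset by (intro mat_vec_harmonic_proj_in_harmonic) blast
  qed
  moreover have "u k = 0"
    if u: "\<forall>j\<in>{0..i}. u j \<in> harmonic l s j" "(\<Sum>j\<in>{0..i}. u j) = 0" and k: "k \<in> {0..i}" for u k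
  proof -
    have "0 = mat_vec (johnson_points l s) (harmonic_proj l s k) (\<Sum>j\<in>{0..i}. u j)"
      using u(2) by (simp add: linear_0[OF linear_mat_vec])
    also have "\<dots> = (\<Sum>j\<in>{0..i}. mat_vec (johnson_points l s) (harmonic_proj l s k) (u j))"
      by (rule linear_sum[OF linear_mat_vec])
    also have "\<dots> = (\<Sum>j\<in>{0..i}. if k = j then u j else 0)"
      using u(1) by (intro sum.cong) (auto simp: mat_vec_harmonic_proj_harmonic)
    also have "\<dots> = u k"
      using k by simp
    finally show ?thesis ..
  qed
  ultimately show ?thesis
    unfolding is_direct_sum_def by blast
qed

text \<open>
  The functions of degree zero are the constants, and the projection onto them is averaging.
\<close>

lemma harmonic_proj_0:
  "harmonic_proj l s 0 = (\<lambda>A B. if A \<in> johnson_points l s \<and> B \<in> johnson_points l s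
    then 1 / real (card (johnson_points l s)) else 0)"
proof (intro ext)
  fix A B
  let ?X = "johnson_points l s"
  let ?u = "(1 / real (card ?X)) *\<^sub>R superset_function l s {}"
  have P0: "orth_proj ?X (low_degree l s 0) f = 0" for f
    using orth_proj_mem[OF low_degree_facts, of l s 0 f] by (simp add: low_degree_0)
  have "orth_proj ?X (low_degree l s (Suc 0)) (indicat_real {B}) = ?u" if "B \<in> ?X"
  proof (rule orth_proj_unique[OF low_degree_facts])
    show "?u \<in> low_degree l s (Suc 0)"
      by (intro subspace_scale subspace_low_degree superset_function_in_low_degree) auto
    fix w assume w: "w \<in> low_degree l s (Suc 0)"
    have "inner_on ?X (indicat_real {B} - ?u) (superset_function l s {}) = 0"
    proof -
      have "inner_on ?X (indicat_real {B}) (superset_function l s {}) = 1"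
        using that finite_johnson_points[of l s]
        by (simp add: inner_on_def indicator_def superset_function_def)
      moreover have "inner_on ?X (superset_function l s {}) (superset_function l s {}) = card ?X"
        by (simp add: inner_on_def superset_function_def)
      moreover have "card ?X \<noteq> 0"
        using that finite_johnson_points[of l s] by auto
      ultimately show ?thesis
        by (simp add: inner_on_simps)
    qed
    then show "inner_on ?X (indicat_real {B} - ?u) w = 0"
      using w orthogonal_span[of "{superset_function l s {}}" ?X "indicat_real {B} - ?u" w]
      by (simp add: low_degree_1)
  qed
  then show "harmonic_proj l s 0 A B = (if A \<in> ?X \<and> B \<in> ?X then 1 / real (card ?X) else 0)"
    by (simp add: harmonic_proj_def proj_mat_def P0 superset_function_def)
qed

lemma harmonic_proj_eq_0:
  assumes "s < i"
  shows "harmonic_proj l s i = 0"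
  using assms by (simp add: harmonic_proj_def low_degree_top)

lemma harmonic_proj_nonzero:
  assumes "i \<le> s" and "2 * s \<le> l"
  shows "harmonic_proj l s i \<noteq> 0"
proof
  assume "harmonic_proj l s i = 0"
  obtain h where h: "h \<in> harmonic l s i" "h \<noteq> 0"
    using harmonic_nonzero assms by blast
  have "h = mat_vec (johnson_points l s) (harmonic_proj l s i) h"
    using mat_vec_harmonic_proj_harmonic[OF h(1), of i] by simp
  also have "\<dots> = 0"
    using \<open>harmonic_proj l s i = 0\<close> by (simp add: linear_0[OF linear_mat_vec_left])
  finally show False
    using h(2) by simp
qed

lemma inj_on_harmonic_proj:
  assumes "2 * s \<le> l"
  shows "inj_on (harmonic_proj l s) {0..s}"
proof (rule inj_onI, rule ccontr)
  fix i j assume "i \<in> {0..s}" "harmonic_proj l s i = harmonic_proj l s j" "i \<noteq> j"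
  then have "harmonic_proj l s i = 0"
    using harmonic_proj_mult[of l s i i] harmonic_proj_mult[of l s i j] by simp
  then show False
    using harmonic_proj_nonzero \<open>i \<in> {0..s}\<close> assms by auto
qed


section \<open>The Johnson algebra\<close>

text \<open>
  The coefficient of a relation matrix is the common value of \<open>M\<close> on the relation, and arbitrary if
  the relation is empty.
\<close>

lemma johnson_algebra_memI:
  assumes "\<And>A B. A \<notin> johnson_points l s \<or> B \<notin> johnson_points l s \<Longrightarrow> M A B = 0"
    and "\<And>A B C D. A \<in> johnson_points l s \<Longrightarrow> B \<in> johnson_points l s \<Longrightarrow>
      C \<in> johnson_points l s \<Longrightarrow> D \<in> johnson_points l s \<Longrightarrow>
      card (A \<inter> B) = card (C \<inter> D) \<Longrightarrow> M A B = M C D"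
  shows "M \<in> johnson_algebra l s"
proof -
  let ?X = "johnson_points l s"
  have "\<forall>i. \<exists>c. \<forall>A B. (A, B) \<in> johnson_rel l s i \<longrightarrow> M A B = c"
  proof
    fix i
    show "\<exists>c. \<forall>A B. (A, B) \<in> johnson_rel l s i \<longrightarrow> M A B = c"
    proof (cases "johnson_rel l s i = {}")
      case False
      then obtain A B where "(A, B) \<in> johnson_rel l s i" by auto
      then show ?thesis
        using assms(2) by (intro exI[of _ "M A B"]) (auto simp: johnson_rel_def)
    qed simp
  qed
  then obtain c where c: "\<And>i A B. (A, B) \<in> johnson_rel l s i \<Longrightarrow> M A B = c i"
    by metis
  have "M = (\<Sum>i\<in>{0..s}. c i *\<^sub>R relation_mat (johnson_rel l s i))"
  proof (intro ext)
    fix A B :: "nat set"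
    let ?k = "s - card (A \<inter> B)"
    show "M A B = (\<Sum>i\<in>{0..s}. c i *\<^sub>R relation_mat (johnson_rel l s i)) A B"
    proof (cases "A \<in> ?X \<and> B \<in> ?X")
      case True
      then have "card (A \<inter> B) \<le> s"
        using card_mono[of A "A \<inter> B"] finite_johnson_point[of A l s]
        by (auto simp: johnson_points_def)
      then have rel: "(A, B) \<in> johnson_rel l s i \<longleftrightarrow> i = ?k" if "i \<le> s" for i
        using that True by (auto simp: johnson_rel_def)
      have "(\<Sum>i\<in>{0..s}. c i *\<^sub>R relation_mat (johnson_rel l s i)) A B
          = (\<Sum>i\<in>{0..s}. if i = ?k then c i else 0)"
        unfolding sum_fun_apply by (intro sum.cong) (auto simp: relation_mat_def rel)
      also have "\<dots> = c ?k"
        by simp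
      also have "\<dots> = M A B"
        using c[of A B ?k] rel[of ?k] by simp
      finally show ?thesis ..
    next
      case False
      then have "relation_mat (johnson_rel l s i) A B = 0" for i
        by (auto simp: relation_mat_def johnson_rel_def)
      then show ?thesis
        using False assms(1) by (simp add: sum_fun_apply)
    qed
  qed
  moreover have "(\<Sum>i\<in>{0..s}. c i *\<^sub>R relation_mat (johnson_rel l s i)) \<in> johnson_algebra l s"
    unfolding johnson_algebra_def by (intro span_sum span_scale span_base imageI)
  ultimately show ?thesis by simp
qed

text \<open>
  Equivariance of the projection, read off from the images of the point indicators.
\<close>

lemma proj_mat_low_degree_image:
  assumes "p permutes {1..l}"
  shows "proj_mat (johnson_points l s) (low_degree l s n) (p ` A) (p ` B)
    = proj_mat (johnson_points l s) (low_degree l s n) A B"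
proof -
  let ?P = "orth_proj (johnson_points l s) (low_degree l s n)"
  have "indicat_real {p ` B} \<circ> (`) p = indicat_real {B}"
    using inj_image_eq_iff[OF permutes_inj[OF assms]] by (auto simp: indicator_def fun_eq_iff)
  moreover have "?P (indicat_real {p ` B} \<circ> (`) p) = ?P (indicat_real {p ` B}) \<circ> (`) p"
  proof (rule orth_proj_equivariant[OF low_degree_facts bij_betw_image_johnson_points[OF assms]])
    show "u \<circ> (`) p \<in> low_degree l s n" if "u \<in> low_degree l s n" for u
      using low_degree_image[OF assms that] .
    show "\<exists>w'\<in>low_degree l s n. w = w' \<circ> (`) p" if "w \<in> low_degree l s n" for w
    proof (rule bexI)
      show "w \<circ> (`) (inv p) \<in> low_degree l s n"
        using low_degree_image[OF permutes_inv[OF assms] that] .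
      show "w = w \<circ> (`) (inv p) \<circ> (`) p"
        using permutes_inverses[OF assms] by (simp add: fun_eq_iff image_image)
    qed
  qed
  ultimately have "?P (indicat_real {B}) = ?P (indicat_real {p ` B}) \<circ> (`) p"
    by simp
  then show ?thesis
    using image_in_johnson_points_iff[OF assms] by (simp add: proj_mat_def)
qed

lemma harmonic_proj_in_johnson_algebra: "harmonic_proj l s i \<in> johnson_algebra l s"
proof (rule johnson_algebra_memI)
  fix A B assume "A \<notin> johnson_points l s \<or> B \<notin> johnson_points l s"
  then show "harmonic_proj l s i A B = 0"
    using harmonic_proj_column[of l s i B] harmonic_subset[of l s i]
    by (auto simp: vectors_on_def harmonic_proj_def proj_mat_def)
next
  fix A B C D
  assume "A \<in> johnson_points l s" "B \<in> johnson_points l s" "C \<in> johnson_points l s"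
    "D \<in> johnson_points l s" "card (A \<inter> B) = card (C \<inter> D)"
  then obtain p where p: "p permutes {1..l}" "p ` A = C" "p ` B = D"
    by (rule permutation_between_pairs)
  show "harmonic_proj l s i A B = harmonic_proj l s i C D"
    using proj_mat_low_degree_image[OF p(1)] by (simp add: harmonic_proj_def flip: p(2,3))
qed

lemma sum_harmonic_proj_mult:
  assumes "i \<le> s"
  shows "mat_mult (johnson_points l s) (\<Sum>k\<in>{0..s}. c k *\<^sub>R harmonic_proj l s k)
    (harmonic_proj l s i) = c i *\<^sub>R harmonic_proj l s i"
    and "mat_mult (johnson_points l s) (harmonic_proj l s i)
    (\<Sum>k\<in>{0..s}. c k *\<^sub>R harmonic_proj l s k) = c i *\<^sub>R harmonic_proj l s i"
proof -
  let ?X = "johnson_points l s"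
  let ?J = "harmonic_proj l s"
  have "mat_mult ?X (\<Sum>k\<in>{0..s}. c k *\<^sub>R ?J k) (?J i) = (\<Sum>k\<in>{0..s}. mat_mult ?X (c k *\<^sub>R ?J k) (?J i))"
    by (rule linear_sum[OF linear_mat_mult_left])
  also have "\<dots> = (\<Sum>k\<in>{0..s}. if k = i then c i *\<^sub>R ?J i else 0)"
    by (intro sum.cong) (simp_all add: mat_mult_simps harmonic_proj_mult)
  finally show "mat_mult ?X (\<Sum>k\<in>{0..s}. c k *\<^sub>R ?J k) (?J i) = c i *\<^sub>R ?J i"
    using assms by simp
  have "mat_mult ?X (?J i) (\<Sum>k\<in>{0..s}. c k *\<^sub>R ?J k) = (\<Sum>k\<in>{0..s}. mat_mult ?X (?J i) (c k *\<^sub>R ?J k))"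
    by (rule linear_sum[OF linear_mat_mult_right])
  also have "\<dots> = (\<Sum>k\<in>{0..s}. if k = i then c i *\<^sub>R ?J i else 0)"
    by (intro sum.cong) (simp_all add: mat_mult_simps harmonic_proj_mult)
  finally show "mat_mult ?X (?J i) (\<Sum>k\<in>{0..s}. c k *\<^sub>R ?J k) = c i *\<^sub>R ?J i"
    using assms by simp
qed

lemma independent_harmonic_proj:
  assumes "2 * s \<le> l"
  shows "independent (harmonic_proj l s ` {0..s})"
proof (rule independent_if_scalars_zero)
  let ?J = "harmonic_proj l s"
  fix f M assume sum0: "(\<Sum>M\<in>?J ` {0..s}. f M *\<^sub>R M) = 0" and "M \<in> ?J ` {0..s}"
  then obtain i where i: "i \<le> s" "M = ?J i"
    by auto
  have "(\<Sum>k\<in>{0..s}. f (?J k) *\<^sub>R ?J k) = 0"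
    using sum0 sum.reindex[OF inj_on_harmonic_proj[OF assms], of "\<lambda>M. f M *\<^sub>R M"] by (simp add: o_def)
  then have "f (?J i) *\<^sub>R ?J i = 0"
    using sum_harmonic_proj_mult(1)[OF i(1), of l "\<lambda>k. f (?J k)"]
    by (simp add: linear_0[OF linear_mat_mult_left])
  then show "f M = 0"
    using i harmonic_proj_nonzero assms by simp
qed simp

text \<open>
  A dimension count: the algebra is spanned by \<open>s + 1\<close> matrices, and the harmonic projections are
  \<open>s + 1\<close> independent members of it.
\<close>

lemma span_harmonic_proj:
  assumes "2 * s \<le> l"
  shows "span (harmonic_proj l s ` {0..s}) = johnson_algebra l s"
proof (rule ccontr)
  let ?J = "harmonic_proj l s ` {0..s}" and ?R = "(\<lambda>i. relation_mat (johnson_rel l s i)) ` {0..s}"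
  assume "span ?J \<noteq> johnson_algebra l s"
  moreover have sub: "?J \<subseteq> johnson_algebra l s"
    using harmonic_proj_in_johnson_algebra by blast
  then have "span ?J \<subseteq> johnson_algebra l s"
    unfolding johnson_algebra_def by (intro span_minimal) auto
  ultimately obtain M where M: "M \<in> johnson_algebra l s" "M \<notin> span ?J"
    by blast
  then have "independent (insert M ?J)"
    by (simp add: independent_insertI independent_harmonic_proj[OF assms])
  moreover have "insert M ?J \<subseteq> span ?R"
    using M(1) sub by (simp add: johnson_algebra_def)
  ultimately have "card (insert M ?J) \<le> card ?R"
    using independent_span_bound[of ?R "insert M ?J"] by simp
  also have "\<dots> \<le> Suc s"
    using card_image_le[of "{0..s}" "\<lambda>i. relation_mat (johnson_rel l s i)"] by simp
  also have "\<dots> = card ?J"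
    using card_image[OF inj_on_harmonic_proj[OF assms]] by simp
  also have "card ?J < card (insert M ?J)"
    using M(2) span_base[of M ?J] by (subst card_insert_disjoint) auto
  finally show False by simp
qed

lemma johnson_algebra_expansion:
  assumes "2 * s \<le> l" and "M \<in> johnson_algebra l s"
  obtains c where "M = (\<Sum>k\<in>{0..s}. c k *\<^sub>R harmonic_proj l s k)"
proof -
  have "M \<in> span (harmonic_proj l s ` {0..s})"
    using assms span_harmonic_proj by simp
  then obtain u where "M = (\<Sum>N\<in>harmonic_proj l s ` {0..s}. u N *\<^sub>R N)"
    by (auto simp: span_finite)
  then have "M = (\<Sum>k\<in>{0..s}. u (harmonic_proj l s k) *\<^sub>R harmonic_proj l s k)"
    using sum.reindex[OF inj_on_harmonic_proj[OF assms(1)], of "\<lambda>M. u M *\<^sub>R M"] by (simp add: o_def)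
  then show ?thesis
    by (rule that)
qed

lemma johnson_algebra_acts_by_scalar:
  assumes "2 * s \<le> l" and "M \<in> johnson_algebra l s"
  shows "\<exists>c. \<forall>v\<in>harmonic l s i. mat_vec (johnson_points l s) M v = c *\<^sub>R v"
proof -
  obtain c where c: "M = (\<Sum>k\<in>{0..s}. c k *\<^sub>R harmonic_proj l s k)"
    using johnson_algebra_expansion assms .
  have "mat_vec (johnson_points l s) M v = (if i \<le> s then c i else 0) *\<^sub>R v"
    if v: "v \<in> harmonic l s i" for v
  proof -
    have "mat_vec (johnson_points l s) M v
        = (\<Sum>k\<in>{0..s}. mat_vec (johnson_points l s) (c k *\<^sub>R harmonic_proj l s k) v)"
      unfolding c by (rule linear_sum[OF linear_mat_vec_left])
    also have "\<dots> = (\<Sum>k\<in>{0..s}. if k = i then c i *\<^sub>R v else 0)"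
      by (intro sum.cong)
        (simp_all add: linear_scale[OF linear_mat_vec_left] mat_vec_harmonic_proj_harmonic[OF v])
    finally show ?thesis by simp
  qed
  then show ?thesis by blast
qed


section \<open>The cometric idempotents are the harmonic projections\<close>

lemma idempotent_harmonic_proj:
  "idempotent_in (johnson_points l s) (johnson_algebra l s) (harmonic_proj l s i)"
  by (simp add: idempotent_in_def harmonic_proj_in_johnson_algebra harmonic_proj_mult)

text \<open>
  In the basis of orthogonal idempotents the coefficients of an idempotent satisfy \<open>c\<^sup>2 = c\<close>, so each
  of them is \<open>0\<close> or \<open>1\<close>.
\<close>

lemma idempotent_mult_harmonic_proj:
  assumes l: "2 * s \<le> l" and i: "i \<le> s"
    and N: "idempotent_in (johnson_points l s) (johnson_algebra l s) N"
  shows "mat_mult (johnson_points l s) N (harmonic_proj l s i) \<in> {0, harmonic_proj l s i}"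
    and "mat_mult (johnson_points l s) (harmonic_proj l s i) N =
      mat_mult (johnson_points l s) N (harmonic_proj l s i)"
    and "N \<noteq> 0 \<Longrightarrow> \<exists>k\<le>s. mat_mult (johnson_points l s) N (harmonic_proj l s k) = harmonic_proj l s k"
proof -
  let ?X = "johnson_points l s"
  let ?J = "harmonic_proj l s"
  obtain c where c: "N = (\<Sum>k\<in>{0..s}. c k *\<^sub>R ?J k)"
    using johnson_algebra_expansion[OF l] N unfolding idempotent_in_def by blast
  have NJ: "mat_mult ?X N (?J k) = c k *\<^sub>R ?J k" "mat_mult ?X (?J k) N = c k *\<^sub>R ?J k" if "k \<le> s" for k
    unfolding c using that by (rule sum_harmonic_proj_mult)+
  have c01: "c k = 0 \<or> c k = 1" if k: "k \<le> s" for k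
  proof -
    have "mat_mult ?X (?J k) (mat_mult ?X N N) = (c k * c k) *\<^sub>R ?J k"
    proof -
      have "mat_mult ?X (?J k) (mat_mult ?X N N) = mat_mult ?X (mat_mult ?X (?J k) N) N"
        by (simp add: mat_mult_assoc)
      also have "\<dots> = (c k * c k) *\<^sub>R ?J k"
        using k by (simp add: NJ mat_mult_simps)
      finally show ?thesis .
    qed
    moreover have "mat_mult ?X N N = N"
      using N by (simp add: idempotent_in_def)
    ultimately have "(c k * c k - c k) *\<^sub>R ?J k = 0"
      using NJ(2)[OF k] by (simp add: scaleR_left_diff_distrib)
    then have "c k * c k - c k = 0"
      using harmonic_proj_nonzero[OF k l] by simp
    then show ?thesis
      by algebra
  qed
  show "mat_mult ?X N (?J i) \<in> {0, ?J i}" and "mat_mult ?X (?J i) N = mat_mult ?X N (?J i)"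
    using c01[OF i] by (auto simp: NJ[OF i])
  show "\<exists>k\<le>s. mat_mult ?X N (?J k) = ?J k" if "N \<noteq> 0"
  proof (rule ccontr)
    assume "\<not> ?thesis"
    then have "c k = 0" if "k \<le> s" for k
      using c01 NJ(1) that by force
    then have "N = 0"
      unfolding c by (intro sum.neutral) simp
    then show False
      using \<open>N \<noteq> 0\<close> by simp
  qed
qed

text \<open>
  If \<open>J\<^sub>i = N + P\<close> with \<open>N P = 0\<close>, then \<open>N J\<^sub>i = N\<close>. By the preceding lemma this forces \<open>N = 0\<close> or
  \<open>N = J\<^sub>i\<close>, and in the latter case \<open>P = 0\<close>.
\<close>

lemma primitive_harmonic_proj:
  assumes l: "2 * s \<le> l" and i: "i \<le> s"
  shows "primitive_idempotent_in (johnson_points l s) (johnson_algebra l s) (harmonic_proj l s i)"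
  unfolding primitive_idempotent_in_def
proof (intro conjI)
  let ?X = "johnson_points l s"
  have False if N: "idempotent_in ?X (johnson_algebra l s) N" and ne: "N \<noteq> 0" "P \<noteq> 0"
    and NP: "mat_mult ?X N P = 0" and sum: "harmonic_proj l s i = N + P" for N P
  proof -
    have "mat_mult ?X N (harmonic_proj l s i) = N"
      using N NP by (simp add: sum mat_mult_simps idempotent_in_def)
    then have "N = harmonic_proj l s i"
      using idempotent_mult_harmonic_proj(1)[OF l i N] ne by simp
    then show False
      using sum ne by simp
  qed
  then show "\<nexists>N P. idempotent_in ?X (johnson_algebra l s) N \<and> idempotent_in ?X (johnson_algebra l s) P
      \<and> N \<noteq> 0 \<and> P \<noteq> 0 \<and> mat_mult ?X N P = 0 \<and> mat_mult ?X P N = 0 \<and> harmonic_proj l s i = N + P"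
    by blast
qed (use assms idempotent_harmonic_proj harmonic_proj_nonzero in auto)

text \<open>
  Some \<open>J\<^sub>i\<close> occurs in the expansion of the idempotent \<open>M\<close> with coefficient one. Then
  \<open>M = J\<^sub>i + (M - J\<^sub>i)\<close> is a decomposition into orthogonal idempotents, and primitivity leaves only
  \<open>M = J\<^sub>i\<close>.
\<close>

lemma primitive_idempotent_is_harmonic_proj:
  assumes l: "2 * s \<le> l"
    and M: "primitive_idempotent_in (johnson_points l s) (johnson_algebra l s) M"
  shows "\<exists>i\<le>s. M = harmonic_proj l s i"
proof -
  let ?X = "johnson_points l s"
  let ?I = "idempotent_in ?X (johnson_algebra l s)"
  have idem: "?I M" and "M \<noteq> 0"
    using M by (auto simp: primitive_idempotent_in_def)
  then obtain i where i: "i \<le> s" and MJ: "mat_mult ?X M (harmonic_proj l s i) = harmonic_proj l s i"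
    using idempotent_mult_harmonic_proj(3)[OF l order_refl] by blast
  then have JM: "mat_mult ?X (harmonic_proj l s i) M = harmonic_proj l s i"
    using idempotent_mult_harmonic_proj(2)[OF l i idem] by simp
  let ?N = "harmonic_proj l s i" and ?P = "M - harmonic_proj l s i"
  have MM: "mat_mult ?X M M = M"
    using idem by (simp add: idempotent_in_def)
  have "?P \<in> johnson_algebra l s"
    using idem harmonic_proj_in_johnson_algebra[of l s i]
    unfolding idempotent_in_def johnson_algebra_def by (auto intro: span_diff)
  then have "?I ?P"
    unfolding idempotent_in_def mat_mult_simps MM MJ JM by (simp add: harmonic_proj_mult)
  moreover have "mat_mult ?X ?N ?P = 0" "mat_mult ?X ?P ?N = 0" "M = ?N + ?P"
    unfolding mat_mult_simps MJ JM by (simp_all add: harmonic_proj_mult)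
  ultimately have "?P = 0"
    using M idempotent_harmonic_proj[of l s i] harmonic_proj_nonzero[OF i l]
    unfolding primitive_idempotent_in_def by blast
  then show ?thesis
    using i by auto
qed

lemma is_cometric_harmonic_proj:
  assumes "2 * s \<le> l"
  shows "is_cometric_idempotents l s (harmonic_proj l s)"
  unfolding is_cometric_idempotents_def Let_def
proof (intro conjI ballI allI impI)
  show "primitive_idempotent_in (johnson_points l s) (johnson_algebra l s) (harmonic_proj l s i)"
    if "i \<in> {0..s}" for i
    using primitive_harmonic_proj assms that by simp
  show "is_direct_sum {0..i} (\<lambda>j. column_space (johnson_points l s) (harmonic_proj l s j))
    (span (superset_function l s ` {S. S \<subseteq> {1..l} \<and> card S = i}))" if "i \<in> {0..s}" for i
    using direct_sum_harmonic[of i l s] low_degree_Suc[of i s l] that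
    by (simp add: column_space_harmonic_proj)
qed (use assms in \<open>simp_all add: inj_on_harmonic_proj independent_harmonic_proj span_harmonic_proj
    harmonic_proj_0 harmonic_proj_eq_0\<close>)

text \<open>
  A cometric sequence \<open>K\<close> consists of primitive idempotents, so \<open>K\<^sub>i = J\<^sub>q\<^sub>i\<close> for some indices \<open>q\<^sub>i\<close>.
  The column space of \<open>K\<^sub>i\<close> consists of functions of degree at most \<open>i\<close>, whence \<open>q\<^sub>i \<le> i\<close>; and an
  injective map of an initial segment with this property is the identity.
\<close>

lemma is_cometric_idempotents_unique:
  assumes l: "2 * s \<le> l" and K: "is_cometric_idempotents l s K"
  shows "K = harmonic_proj l s"
proof -
  let ?X = "johnson_points l s"
  have "\<forall>i\<in>{0..s}. \<exists>j\<le>s. K i = harmonic_proj l s j"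
    using K primitive_idempotent_is_harmonic_proj[OF l]
    unfolding is_cometric_idempotents_def Let_def by blast
  then obtain q where q: "\<And>i. i \<le> s \<Longrightarrow> q i \<le> s \<and> K i = harmonic_proj l s (q i)"
    by (metis atLeastAtMost_iff bot_nat_0.extremum)
  have inj: "inj_on K {0..s}"
    using K by (simp add: is_cometric_idempotents_def Let_def)
  have le: "q i \<le> i" if i: "i \<le> s" for i
  proof (rule ccontr)
    assume "\<not> q i \<le> i"
    obtain h where h: "h \<in> harmonic l s (q i)" "h \<noteq> 0"
      using harmonic_nonzero[of "q i"] q[OF i] l by blast
    have "is_direct_sum {0..i} (\<lambda>j. column_space ?X (K j)) (low_degree l s (Suc i))"
      using K i by (simp add: is_cometric_idempotents_def Let_def low_degree_Suc)
    then have sums: "{\<Sum>j\<in>{0..i}. u j | u. \<forall>j\<in>{0..i}. u j \<in> column_space ?X (K j)}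
        = low_degree l s (Suc i)"
      unfolding is_direct_sum_def by (rule conjunct1)
    \<comment> \<open>Place \<open>h\<close> in the summand with index \<open>i\<close> and zero in the others.\<close>
    have "h \<in> column_space ?X (K i)" "\<And>j. 0 \<in> column_space ?X (K j)"
      using h(1) q[OF i] by (simp_all add: column_space_harmonic_proj)
        (simp add: column_space_def span_zero)
    then have "(\<Sum>j\<in>{0..i}. if j = i then h else 0)
        \<in> {\<Sum>j\<in>{0..i}. u j | u. \<forall>j\<in>{0..i}. u j \<in> column_space ?X (K j)}"
      by (intro CollectI exI[of _ "\<lambda>j. if j = i then h else 0"]) simp
    then have "h \<in> low_degree l s (Suc i)"
      unfolding sums by simp
    then have "h \<in> low_degree l s (q i)"
      using low_degree_mono[of "Suc i" "q i" l s] \<open>\<not> q i \<le> i\<close> by auto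
    then have "inner_on ?X h h = 0"
      using h(1) by (simp add: harmonic_def)
    then show False
      using inner_on_self_eq_0[OF finite_johnson_points] h harmonic_subset by blast
  qed
  have eq: "q i = i" if "i \<le> s" for i
    using that
  proof (induction i rule: less_induct)
    case (less i)
    show ?case
    proof (rule ccontr)
      assume "q i \<noteq> i"
      then have "q (q i) = q i"
        using le[OF less.prems] less.prems by (intro less.IH) auto
      then have "K (q i) = K i"
        using q[OF less.prems] q[of "q i"] by simp
      then show False
        using inj_onD[OF inj] \<open>q i \<noteq> i\<close> q[OF less.prems] less.prems by auto
    qed
  qed
  show ?thesis
  proof
    fix i
    show "K i = harmonic_proj l s i"
    proof (cases "i \<le> s")
      case True
      then show ?thesis using q[OF True] eq[OF True] by simp
    next
      case False
      then show ?thesis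
        using K harmonic_proj_eq_0[of s i l] by (simp add: is_cometric_idempotents_def Let_def)
    qed
  qed
qed

lemma johnson_idempotent_eq:
  assumes "2 * s \<le> l"
  shows "johnson_idempotent l s = harmonic_proj l s"
  unfolding johnson_idempotent_def
  using is_cometric_harmonic_proj is_cometric_idempotents_unique assms by blast


section \<open>The Kneser graph\<close>

lemma kneser_degree:
  assumes "A \<in> johnson_points l s"
  shows "degree_in (kneser_edges l s) A = (l - s) choose s"
proof -
  have "{B. (A, B) \<in> kneser_edges l s} = {B. B \<subseteq> {1..l} - A \<and> card B = s}"
    using assms by (auto simp: kneser_edges_iff johnson_points_def)
  moreover have "card ({1..l} - A) = l - s"
    using assms finite_johnson_point[OF assms] by (simp add: johnson_points_def card_Diff_subset)
  ultimately show ?thesis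
    by (simp add: degree_in_def n_subsets)
qed

lemma regular_kneser:
  assumes "0 < s" and "2 * s \<le> l"
  shows "regular_graph (johnson_points l s) (kneser_edges l s)"
  unfolding regular_graph_def
proof (intro conjI)
  show "sym (kneser_edges l s)"
    unfolding sym_def kneser_edges_iff by blast
  show "irrefl (kneser_edges l s)"
    using assms(1) by (auto simp: irrefl_def kneser_edges_iff johnson_points_def)
  show "kneser_edges l s \<subseteq> johnson_points l s \<times> johnson_points l s"
    by (auto simp: kneser_edges_iff)
  show "\<exists>d>0. \<forall>A\<in>johnson_points l s. degree_in (kneser_edges l s) A = d"
    using assms(2) by (intro exI[of _ "(l - s) choose s"]) (simp add: kneser_degree)
qed (rule finite_johnson_points)

lemma laplacian_entry:
  assumes "finite V" and "E \<subseteq> V \<times> V"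
  shows "laplacian V E x y = relation_mat E x y / real (degree_in E y) - (if x \<in> V \<and> x = y then 1 else 0)"
proof -
  have "(\<Sum>z\<in>V. relation_mat E x z * diag_mat V (\<lambda>v. 1 / real (degree_in E v)) z y)
      = (\<Sum>z\<in>V. if z = y then relation_mat E x y / real (degree_in E y) else 0)"
    by (intro sum.cong) (auto simp: diag_mat_def)
  also have "\<dots> = relation_mat E x y / real (degree_in E y)"
    using assms by (auto simp: relation_mat_def)
  finally show ?thesis
    by (simp add: laplacian_def mat_mult_def diag_mat_def)
qed

text \<open>
  The relation at \<open>(A, B)\<close> is recorded by \<open>|A \<inter> B|\<close>, which tells both adjacency (value \<open>0\<close>) and
  equality (value \<open>s\<close>).
\<close>

lemma kneser_laplacian_in_johnson_algebra:
  "laplacian (johnson_points l s) (kneser_edges l s) \<in> johnson_algebra l s"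
proof -
  let ?X = "johnson_points l s"
  have entry: "laplacian ?X (kneser_edges l s) A B =
    relation_mat (kneser_edges l s) A B / real (degree_in (kneser_edges l s) B)
      - (if A \<in> ?X \<and> A = B then 1 else 0)" for A B
    by (rule laplacian_entry) (auto simp: finite_johnson_points kneser_edges_iff)
  show ?thesis
  proof (rule johnson_algebra_memI)
    fix A B assume "A \<notin> ?X \<or> B \<notin> ?X"
    then show "laplacian ?X (kneser_edges l s) A B = 0"
      by (auto simp: entry relation_mat_def kneser_edges_iff)
  next
    fix A B C D
    assume mem: "A \<in> ?X" "B \<in> ?X" "C \<in> ?X" "D \<in> ?X" and card: "card (A \<inter> B) = card (C \<inter> D)"
    have disjoint_iff: "A' \<inter> B' = {} \<longleftrightarrow> card (A' \<inter> B') = 0" if "A' \<in> ?X" for A' B'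
      using finite_johnson_point[OF that] by simp
    have eq_iff: "A' = B' \<longleftrightarrow> card (A' \<inter> B') = s" if "A' \<in> ?X" "B' \<in> ?X" for A' B'
    proof
      assume "card (A' \<inter> B') = s"
      then have "A' \<inter> B' = A'" "A' \<inter> B' = B'"
        using card_subset_eq[OF finite_johnson_point[OF that(1)], of "A' \<inter> B'"]
          card_subset_eq[OF finite_johnson_point[OF that(2)], of "A' \<inter> B'"] that
        by (simp_all add: johnson_points_def)
      then show "A' = B'" by simp
    qed (use that in \<open>simp add: johnson_points_def\<close>)
    show "laplacian ?X (kneser_edges l s) A B = laplacian ?X (kneser_edges l s) C D"
      using mem card
      by (simp add: entry relation_mat_def kneser_edges_iff kneser_degree disjoint_iff eq_iff)
  qed
qed

text \<open>
  The sets in \<open>X\<close> that avoid \<open>a\<close> are the \<open>s\<close>-subsets of an \<open>(l - 1)\<close>-set; Pascal's rule and the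
  absorption identity for binomial coefficients do the rest.
\<close>

lemma star_card:
  assumes "a \<in> {1..l}" and "0 < s"
  shows "real (card {A \<in> johnson_points l s. a \<in> A}) = real s / real l * real (card (johnson_points l s))"
proof -
  let ?X = "johnson_points l s"
  have X: "card ?X = l choose s"
    unfolding johnson_points_def using n_subsets[of "{1..l}" s] by simp
  have "{A \<in> ?X. a \<in> A} = ?X - {A. A \<subseteq> {1..l} - {a} \<and> card A = s}"
    by (auto simp: johnson_points_def)
  moreover have "{A. A \<subseteq> {1..l} - {a} \<and> card A = s} \<subseteq> ?X"
    by (auto simp: johnson_points_def)
  moreover have "card {A. A \<subseteq> {1..l} - {a} \<and> card A = s} = (l - 1) choose s"
    using assms(1) by (simp add: n_subsets)
  ultimately have "card {A \<in> ?X. a \<in> A} = (l choose s) - ((l - 1) choose s)"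
    using X finite_johnson_points[of l s] by (simp add: card_Diff_subset finite_subset)
  also have "\<dots> = (l - 1) choose (s - 1)"
    using assms by (simp add: choose_reduce_nat[of l s])
  finally have "s * card ?X = l * card {A \<in> ?X. a \<in> A}"
    using times_binomial_minus1_eq[of s l] X assms(2) by simp
  then have "real s * real (card ?X) = real l * real (card {A \<in> ?X. a \<in> A})"
    by (metis of_nat_mult)
  then show ?thesis
    using assms(1) by (simp add: field_simps)
qed


section \<open>Eigenbases and the star of a point\<close>

lemma harmonic_orthogonal:
  assumes "v \<in> harmonic l s i" and "w \<in> harmonic l s j" and "i \<noteq> j"
  shows "inner_on (johnson_points l s) v w = 0"
proof (cases "i < j")
  case True
  then have "v \<in> low_degree l s j"
    using assms(1) harmonic_subset_low_degree by blast
  then show ?thesis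
    using assms(2) by (simp add: harmonic_def inner_on_commute[of _ v])
next
  case False
  then have "w \<in> low_degree l s i"
    using assms(2,3) harmonic_subset_low_degree[of j i l s] by auto
  then show ?thesis
    using assms(1) by (simp add: harmonic_def)
qed

lemma constant_in_harmonic_0: "superset_function l s {} \<in> harmonic l s 0"
  by (simp add: harmonic_def low_degree_0 inner_on_simps superset_function_in_low_degree)

text \<open>
  Let \<open>E\<close> be the set of all harmonic functions, of whatever degree, that are orthogonal to \<open>1\<close> and
  \<open>g\<close>. The set \<open>{1, g} \<union> E\<close> consists of eigenvectors (and zero), and it spans everything because
  \<open>1\<close> spans \<open>V\<^sub>0\<close> and because \<open>V\<^sub>i\<close> is the sum of the line of \<open>g\<close> and of its orthogonal complement.
  Extending \<open>{1, g}\<close> to a basis inside this set gives the claim.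
\<close>

lemma johnson_algebra_eigenbasis:
  assumes l: "2 * s \<le> l" and M: "M \<in> johnson_algebra l s"
    and g: "g \<in> harmonic l s i" "g \<noteq> 0" and i: "i \<noteq> 0"
  obtains B where "superset_function l s {} \<in> B" and "g \<in> B" and "independent B"
    and "span B = vectors_on (johnson_points l s)"
    and "\<And>f. f \<in> B \<Longrightarrow> is_eigenvector (johnson_points l s) M f"
    and "\<And>f. f \<in> B \<Longrightarrow> f \<noteq> superset_function l s {} \<Longrightarrow> f \<noteq> g \<Longrightarrow>
      inner_on (johnson_points l s) f (superset_function l s {}) = 0
      \<and> inner_on (johnson_points l s) f g = 0"
proof -
  let ?X = "johnson_points l s"
  define one where "one = superset_function l s {}"
  have one: "one \<in> harmonic l s 0"
    unfolding one_def by (rule constant_in_harmonic_0)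
  have g_one: "inner_on ?X g one = 0"
    using g(1) one i by (rule harmonic_orthogonal)
  have gg: "inner_on ?X g g \<noteq> 0"
    using inner_on_self_eq_0[OF finite_johnson_points] g harmonic_subset by blast
  have "one \<noteq> 0"
  proof -
    have "{1..s} \<in> ?X"
      using l by (auto simp: johnson_points_def)
    then have "one {1..s} = 1"
      by (simp add: one_def superset_function_def)
    then show ?thesis by auto
  qed
  then have one_one: "inner_on ?X one one \<noteq> 0"
    using inner_on_self_eq_0[OF finite_johnson_points] one harmonic_subset by blast
  define E where "E = {f. (\<exists>j. f \<in> harmonic l s j) \<and> inner_on ?X f one = 0 \<and> inner_on ?X f g = 0}"
  let ?S = "{one, g} \<union> E"
  have S_harmonic: "\<exists>j. f \<in> harmonic l s j" if "f \<in> ?S" for f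
    using that one g(1) by (auto simp: E_def)
  have "one \<notin> span {g}"
  proof
    assume "one \<in> span {g}"
    then obtain c where "one = c *\<^sub>R g"
      by (auto simp: span_singleton)
    then have "inner_on ?X one one = c * inner_on ?X g one"
      by (simp add: inner_on_simps)
    then show False
      using one_one g_one by simp
  qed
  then have "independent {one, g}"
    using g(2) by (intro independent_insertI independent_empty) auto
  then obtain B where B: "{one, g} \<subseteq> B" "B \<subseteq> ?S" "independent B" "?S \<subseteq> span B"
    using maximal_independent_subset_extend[of "{one, g}" ?S] by blast
  have comp: "v \<in> span ?S" if v: "v \<in> harmonic l s j" for v j
  proof -
    consider "j = 0" | "j = i" | "j \<noteq> 0" "j \<noteq> i" by blast
    then show ?thesis
    proof cases
      case 1
      then have "v \<in> span {one}"
        using v low_degree_1[of l s] by (simp add: harmonic_def one_def)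
      then show ?thesis
        using span_mono[of "{one}" ?S] by blast
    next
      case 2
      define c where "c = inner_on ?X v g / inner_on ?X g g"
      have "v - c *\<^sub>R g \<in> harmonic l s i"
        using v g(1) 2 by (intro subspace_diff subspace_scale subspace_harmonic) auto
      moreover have "inner_on ?X v one = 0"
        using harmonic_orthogonal[OF v one] 2 i by simp
      ultimately have "v - c *\<^sub>R g \<in> E"
        using gg g_one by (auto simp: E_def c_def inner_on_simps)
      then have "(v - c *\<^sub>R g) + c *\<^sub>R g \<in> span ?S"
        by (intro span_add span_scale span_base) auto
      then show ?thesis by simp
    next
      case 3
      then have "v \<in> E"
        using v harmonic_orthogonal[OF v one] harmonic_orthogonal[OF v g(1)] by (auto simp: E_def)
      then show ?thesis
        by (intro span_base) auto
    qed
  qed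
  have "vectors_on ?X \<subseteq> span ?S"
  proof
    fix f assume f: "f \<in> vectors_on ?X"
    then have "(\<Sum>j\<in>{0..s}. mat_vec ?X (harmonic_proj l s j) f) = f"
      using low_degree_top[of s "Suc s" l] by (intro sum_mat_vec_harmonic_proj) simp
    moreover have "(\<Sum>j\<in>{0..s}. mat_vec ?X (harmonic_proj l s j) f) \<in> span ?S"
      by (intro span_sum comp[OF mat_vec_harmonic_proj_in_harmonic[OF f]])
    ultimately show "f \<in> span ?S"
      by (simp only:)
  qed
  moreover have "span ?S \<subseteq> span B"
    using B(4) by (intro span_minimal) auto
  moreover have "B \<subseteq> vectors_on ?X"
    using B(2) S_harmonic harmonic_subset by blast
  then have "span B \<subseteq> vectors_on ?X"
    by (intro span_minimal subspace_vectors_on)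
  ultimately have span_B: "span B = vectors_on ?X"
    by blast
  have eig: "is_eigenvector ?X M f" if f: "f \<in> B" for f
  proof -
    obtain j where j: "f \<in> harmonic l s j"
      using f B(2) S_harmonic by blast
    then obtain c where "mat_vec ?X M f = c *\<^sub>R f"
      using johnson_algebra_acts_by_scalar[OF l M] by blast
    moreover have "f \<noteq> 0"
      using f B(3) dependent_zero by blast
    ultimately show ?thesis
      using j harmonic_subset unfolding is_eigenvector_def by blast
  qed
  have orth: "inner_on ?X f one = 0 \<and> inner_on ?X f g = 0" if "f \<in> B" "f \<noteq> one" "f \<noteq> g" for f
    using that B(2) unfolding E_def by blast
  show ?thesis
    using that[of B] B(1,3) span_B eig orth unfolding one_def by blast
qed

text \<open>
  The indicator of the star of \<open>a\<close>, centred by its mean.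
\<close>

definition star_harmonic :: "nat \<Rightarrow> nat \<Rightarrow> nat \<Rightarrow> nat set \<Rightarrow> real"
  where "star_harmonic l s a =
    superset_function l s {a} - (real s / real l) *\<^sub>R superset_function l s {}"

lemma inner_superset_functions:
  "inner_on (johnson_points l s) (superset_function l s S) (superset_function l s T)
    = real (card {A \<in> johnson_points l s. S \<union> T \<subseteq> A})"
proof -
  have "inner_on (johnson_points l s) (superset_function l s S) (superset_function l s T)
      = (\<Sum>A\<in>johnson_points l s. if S \<union> T \<subseteq> A then 1 else 0)"
    unfolding inner_on_def by (intro sum.cong) (auto simp: superset_function_def)
  also have "\<dots> = real (card {A \<in> johnson_points l s. S \<union> T \<subseteq> A})"
    using finite_johnson_points[of l s] by (simp flip: sum.inter_filter)
  finally show ?thesis .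
qed

lemma star_harmonic_in_harmonic:
  assumes "a \<in> {1..l}" and "0 < s"
  shows "star_harmonic l s a \<in> harmonic l s 1"
proof -
  let ?X = "johnson_points l s" and ?one = "superset_function l s {}"
  have "star_harmonic l s a \<in> low_degree l s (Suc 1)"
    unfolding star_harmonic_def using assms(1)
    by (intro subspace_diff subspace_scale subspace_low_degree superset_function_in_low_degree) auto
  moreover have "inner_on ?X (star_harmonic l s a) ?one = 0"
    using star_card[OF assms]
    by (simp add: star_harmonic_def inner_on_simps inner_superset_functions)
  then have "inner_on ?X (star_harmonic l s a) w = 0" if "w \<in> low_degree l s 1" for w
    using orthogonal_span[of "{?one}" ?X "star_harmonic l s a" w] that by (simp add: low_degree_1)
  ultimately show ?thesis
    by (simp add: harmonic_def)
qed

lemma star_harmonic_nonzero: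
  assumes "a \<in> {1..l}" and "0 < s" and "s < l"
  shows "star_harmonic l s a \<noteq> 0"
proof -
  have "s - 1 \<le> card ({1..l} - {a})"
    using assms by simp
  then obtain B where "B \<subseteq> {1..l} - {a}" "card B = s - 1" "finite B"
    by (rule obtain_subset_with_card_n)
  then have "insert a B \<in> johnson_points l s"
    using assms by (auto simp: johnson_points_def card_insert_if)
  then have "star_harmonic l s a (insert a B) = 1 - real s / real l"
    by (simp add: star_harmonic_def superset_function_def)
  then show ?thesis
    using assms(3) by auto
qed

lemma indicator_star:
  "indicat_real {A \<in> johnson_points l s. a \<in> A} =
    star_harmonic l s a + (real s / real l) *\<^sub>R superset_function l s {}"
  by (auto simp: star_harmonic_def fun_eq_iff superset_function_def indicator_def)

lemma extremal_design_star:
  assumes a: "a \<in> {1..l}" and s: "0 < s" and l: "2 * s \<le> l"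
  shows "extremal_design (johnson_points l s) (kneser_edges l s) {A \<in> johnson_points l s. a \<in> A}"
proof -
  let ?X = "johnson_points l s" and ?L = "laplacian (johnson_points l s) (kneser_edges l s)"
  define Y where "Y = {A \<in> ?X. a \<in> A}"
  define one where "one = superset_function l s {}"
  define g where "g = star_harmonic l s a"
  note fin = finite_johnson_points[of l s]
  have Y: "indicat_real Y = g + (real s / real l) *\<^sub>R one"
    unfolding Y_def g_def one_def by (rule indicator_star)
  have g: "g \<in> harmonic l s 1" "g \<noteq> 0"
    unfolding g_def using star_harmonic_in_harmonic star_harmonic_nonzero a s l by auto
  have g_one: "inner_on ?X g one = 0"
    using g(1) constant_in_harmonic_0 unfolding one_def by (rule harmonic_orthogonal) simp
  have gg: "inner_on ?X g g \<noteq> 0"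
    using inner_on_self_eq_0[OF fin] g harmonic_subset by blast
  have Y_sub: "Y \<subseteq> ?X"
    by (auto simp: Y_def)
  \<comment> \<open>Sums over \<open>X\<close> and \<open>Y\<close> are inner products with \<open>1\<close> and with \<open>1\<^sub>Y = g + s / l\<close>.\<close>
  have sumX: "(\<Sum>A\<in>?X. f A) = inner_on ?X f one" for f
    unfolding inner_on_def one_def by (intro sum.cong) (auto simp: superset_function_def)
  have sumY: "(\<Sum>A\<in>Y. f A) = inner_on ?X f g + real s / real l * inner_on ?X f one" for f
  proof -
    have "(\<Sum>A\<in>Y. f A) = inner_on ?X f (indicat_real Y)"
      unfolding inner_on_def using fin Y_sub
      by (intro sum.mono_neutral_cong_left) (auto simp: indicator_def)
    then show ?thesis
      unfolding Y by (simp add: inner_on_simps)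
  qed
  have "Y \<noteq> {}"
    using sumY[of g] gg g_one by auto
  then have Y_pos: "card Y \<noteq> 0" and X_pos: "card ?X \<noteq> 0"
    using fin Y_sub finite_subset[OF Y_sub fin] by auto

  obtain B where B: "one \<in> B" "g \<in> B" "independent B" "span B = vectors_on ?X"
    and eig: "\<And>f. f \<in> B \<Longrightarrow> is_eigenvector ?X ?L f"
    and orth: "\<And>f. f \<in> B \<Longrightarrow> f \<noteq> one \<Longrightarrow> f \<noteq> g \<Longrightarrow> inner_on ?X f one = 0 \<and> inner_on ?X f g = 0"
    using johnson_algebra_eigenbasis[OF l kneser_laplacian_in_johnson_algebra g one_neq_zero]
    unfolding one_def by blast
  have "\<not> integrates ?X Y g"
    using gg g_one Y_pos by (simp add: integrates_def sumX sumY)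
  moreover have "integrates ?X Y one"
  proof -
    have "(\<Sum>A\<in>W. one A) = card W" if "W \<subseteq> ?X" for W
      using that by (simp add: one_def superset_function_def subset_iff)
    then show ?thesis
      using X_pos Y_pos Y_sub by (simp add: integrates_def)
  qed
  moreover have "integrates ?X Y f" if "f \<in> B" "f \<noteq> one" "f \<noteq> g" for f
    using orth[OF that] by (simp add: integrates_def sumX sumY)
  ultimately have "\<exists>!f. f \<in> B \<and> \<not> integrates ?X Y f"
    using B(2) by metis
  then show ?thesis
    unfolding extremal_design_def Y_def[symmetric]
    using regular_kneser[OF s l] Y_sub \<open>Y \<noteq> {}\<close> B(3,4) eig by blast
qed

text \<open>
  The projection of the indicator of the star to \<open>V\<^sub>1\<close> is its centred part, which is not zero.
\<close>

lemma not_t_design_star: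
  assumes a: "a \<in> {1..l}" and s: "0 < s" and l: "2 * s \<le> l" and t: "1 \<le> t"
  shows "\<not> johnson_t_design l s t {A \<in> johnson_points l s. a \<in> A}"
proof
  let ?X = "johnson_points l s"
  assume "johnson_t_design l s t {A \<in> ?X. a \<in> A}"
  then have "mat_vec ?X (harmonic_proj l s 1) (indicat_real {A \<in> ?X. a \<in> A}) = 0"
    using t by (auto simp: johnson_t_design_def johnson_idempotent_eq[OF l])
  moreover have "mat_vec ?X (harmonic_proj l s 1) (indicat_real {A \<in> ?X. a \<in> A}) = star_harmonic l s a"
    unfolding indicator_star
    using mat_vec_harmonic_proj_harmonic[OF star_harmonic_in_harmonic[OF a s], of 1]
      mat_vec_harmonic_proj_harmonic[OF constant_in_harmonic_0, of l s 1]
    by (simp add: linear_add[OF linear_mat_vec] linear_scale[OF linear_mat_vec])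
  ultimately show False
    using star_harmonic_nonzero a s l by auto
qed

theorem proposition6p10:
  fixes l s a :: nat and Y :: "nat set set"
  assumes "2 < s" and "real s \<le> real l / 2"
    and "a \<in> {1..l}"
    and "Y = {A \<in> johnson_points l s. a \<in> A}"
  shows "extremal_design (johnson_points l s) (kneser_edges l s) Y \<and>
    (\<forall>t\<in>{1..s}. \<not> johnson_t_design l s t Y)"
proof -
  have "0 < s" and "2 * s \<le> l"
    using assms(1,2) by auto
  then show ?thesis
    using extremal_design_star not_t_design_star assms(3,4) by simp
qed

end
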